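(* Let $K_n$ be the complete directed graph on $n$ vertices whose edge weights are independent and uniformly distributed on $[0,1]$. Perform a random edge update: choose an edge $e$ uniformly at random among the $n(n-1)$ edges and replace its weight by a new independent uniform $[0,1]$ weight. Then $\mathbb{E}[|\mathcal{SP}^-|]=\mathbb{E}[|\mathcal{SP}^+|]\le (2+o(1))\ln n$.
   Context: Shortest paths are unique with probability 1. Let $\mathcal{SP}_0,\mathcal{SP}_1$ be the sets of shortest paths (one for each ordered pair of vertices) before and after the update, and $\mathcal{SP}_0(e),\mathcal{SP}_1(e)$ the sets of shortest paths before and after the update that pass through $e$. Then $\mathcal{SP}^-=\mathcal{SP}_0(e)\cup(\mathcal{SP}_0\setminus\mathcal{SP}_1)$ and $\mathcal{SP}^+=\mathcal{SP}_1(e)\cup(\mathcal{SP}_1\setminus\mathcal{SP}_0)$. *)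

theory Defs
  imports
    "HOL-Probability.Probability"
    "HOL-Library.Landau_Symbols"
    "Graph_Theory.Weighted_Graph"
    "Graph_Theory.Kuratowski"
begin

section \<open>Shortest paths and their change under an edge update\<close>

text \<open>
  A path is a list of arcs visiting no vertex twice, so its identity does not depend on the
  weights and paths before and after an update can be compared.
\<close>

definition shortest_path ::
    "('a, 'b) pre_digraph \<Rightarrow> 'b weight_fun \<Rightarrow> 'a \<Rightarrow> 'b awalk \<Rightarrow> 'a \<Rightarrow> bool" where
  "shortest_path G w u p v \<longleftrightarrow>
     is_arg_min (wf_digraph.awalk_cost w) (\<lambda>q. pre_digraph.apath G u q v) p"

text \<open>
  When shortest paths are unique, which for independent continuous weights holds almost surely,
  \<open>SP\<close> contains exactly one path for each ordered pair of distinct vertices. The pairs \<open>(v, v)\<close>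
  would only contribute the empty path, which affects neither \<open>SP_minus\<close> nor \<open>SP_plus\<close>.
\<close>

definition SP :: "('a, 'b) pre_digraph \<Rightarrow> 'b weight_fun \<Rightarrow> 'b awalk set" where
  "SP G w = {p. \<exists>u \<in> verts G. \<exists>v \<in> verts G. u \<noteq> v \<and> shortest_path G w u p v}"

definition SP_through :: "('a, 'b) pre_digraph \<Rightarrow> 'b weight_fun \<Rightarrow> 'b \<Rightarrow> 'b awalk set" where
  "SP_through G w e = {p \<in> SP G w. e \<in> set p}"

definition SP_minus ::
    "('a, 'b) pre_digraph \<Rightarrow> 'b weight_fun \<Rightarrow> 'b weight_fun \<Rightarrow> 'b \<Rightarrow> 'b awalk set" where
  "SP_minus G w\<^sub>0 w\<^sub>1 e = SP_through G w\<^sub>0 e \<union> (SP G w\<^sub>0 - SP G w\<^sub>1)"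

definition SP_plus ::
    "('a, 'b) pre_digraph \<Rightarrow> 'b weight_fun \<Rightarrow> 'b weight_fun \<Rightarrow> 'b \<Rightarrow> 'b awalk set" where
  "SP_plus G w\<^sub>0 w\<^sub>1 e = SP_through G w\<^sub>1 e \<union> (SP G w\<^sub>1 - SP G w\<^sub>0)"


section \<open>The random edge update\<close>

definition Kn :: "nat \<Rightarrow> (nat, nat \<times> nat) pre_digraph" where
  "Kn n = \<lparr>verts = {..<n}, arcs = {(u, v). u < n \<and> v < n \<and> u \<noteq> v}, tail = fst, head = snd\<rparr>"

definition uniform01 :: "real measure" where
  "uniform01 = uniform_measure lborel {0..1}"

text \<open>
  The joint law of the weights before the update, the arc to be updated, and its new weight.
\<close>

definition edge_update :: "nat \<Rightarrow> ((nat \<times> nat \<Rightarrow> real) \<times> (nat \<times> nat) \<times> real) measure" where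
  "edge_update n =
     (\<Pi>\<^sub>M a \<in> arcs (Kn n). uniform01) \<Otimes>\<^sub>M (uniform_count_measure (arcs (Kn n)) \<Otimes>\<^sub>M uniform01)"

definition card_SP_minus :: "nat \<Rightarrow> (nat \<times> nat \<Rightarrow> real) \<times> (nat \<times> nat) \<times> real \<Rightarrow> real" where
  "card_SP_minus n = (\<lambda>(w, e, x). real (card (SP_minus (Kn n) w (w(e := x)) e)))"

definition card_SP_plus :: "nat \<Rightarrow> (nat \<times> nat \<Rightarrow> real) \<times> (nat \<times> nat) \<times> real \<Rightarrow> real" where
  "card_SP_plus n = (\<lambda>(w, e, x). real (card (SP_plus (Kn n) w (w(e := x)) e)))"


section \<open>Basic facts\<close>

lemma finite_arcs_Kn: "finite (arcs (Kn n))"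
  by (rule finite_subset[of _ "{..<n} \<times> {..<n}"]) (auto simp: Kn_def)

lemma card_arcs_Kn: "card (arcs (Kn n)) = n * (n - 1)"
proof -
  have "arcs (Kn n) = (SIGMA u:{..<n}. {..<n} - {u})"
    by (auto simp: Kn_def)
  then show ?thesis by simp
qed

lemma complete_digraph_Kn: "complete_digraph n (Kn n)"
  unfolding complete_digraph_def
proof (intro conjI)
  show "graph (Kn n)"
    by unfold_locales
      (auto simp: Kn_def arc_to_ends_def symmetric_conv finite_arcs_Kn[unfolded Kn_def, simplified])
qed (auto simp: Kn_def arcs_ends_conv)

lemma prob_space_uniform01: "prob_space uniform01"
  unfolding uniform01_def by (rule prob_space_uniform_measure) auto

lemma prob_space_edge_update:
  assumes "n \<ge> 2"
  shows "prob_space (edge_update n)"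
proof -
  have "(0, 1) \<in> arcs (Kn n)"
    using assms by (auto simp: Kn_def)
  then interpret E: prob_space "uniform_count_measure (arcs (Kn n))"
    using finite_arcs_Kn by (intro prob_space_uniform_count_measure) auto
  interpret U: prob_space uniform01
    by (rule prob_space_uniform01)
  interpret W: prob_space "\<Pi>\<^sub>M a \<in> arcs (Kn n). uniform01"
    by (intro prob_space_PiM prob_space_uniform01)
  interpret EU: pair_prob_space "uniform_count_measure (arcs (Kn n))" uniform01 ..
  interpret WEU: pair_prob_space "\<Pi>\<^sub>M a \<in> arcs (Kn n). uniform01"
    "uniform_count_measure (arcs (Kn n)) \<Otimes>\<^sub>M uniform01" ..
  show ?thesis
    unfolding edge_update_def by (rule WEU.prob_space_axioms)
qed

lemma awalk_cost_eq: "wf_digraph.awalk_cost w p = sum_list (map w p)"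
proof -
  interpret wf_digraph "\<lparr>verts = {}, arcs = {}, tail = \<lambda>_. (), head = \<lambda>_. ()\<rparr>"
    by unfold_locales auto
  show ?thesis by (rule awalk_cost_def)
qed

end

theory Submission
  imports Defs "HOL-Real_Asymp.Real_Asymp"
begin

text \<open>
  Almost surely shortest paths are unique before and after the update. Write \<open>p\<^sub>0\<close> and \<open>p\<^sub>1\<close> for the
  shortest paths of a pair. Both \<open>SP_minus\<close> and \<open>SP_plus\<close> correspond to the pairs for which the
  updated arc \<open>e\<close> lies on \<open>p\<^sub>0\<close> or \<open>p\<^sub>0 \<noteq> p\<^sub>1\<close>, and for each of these \<open>e\<close> lies on \<open>p\<^sub>0\<close> or on \<open>p\<^sub>1\<close>. Hence the
  expectations agree and are at most twice the expected number of shortest paths through a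
  uniformly random arc, that is, twice the average number of arcs \<open>H\<close> of a shortest path.

  To bound \<open>H\<close>, sum \<open>exp (\<sigma> * length p - l * cost w p)\<close> over all paths \<open>p\<close>. Each shortest path is one of
  the terms, so after taking logarithms \<open>\<sigma> * H\<close> is at most \<open>l\<close> times the average distance plus the logarithm
  of the average of this sum over the pairs. There are at most \<open>n ^ (k + 1)\<close> paths with \<open>k\<close> arcs, each
  contributing at most \<open>exp (\<sigma> * k) / l ^ k\<close> in expectation, which for \<open>l = n * exp \<sigma> * (1 + \<eta>)\<close> sums to
  at most \<open>n / \<eta>\<close>. Following Dijkstra's algorithm from a single vertex bounds the expected sum of the distances
  from it by a harmonic number, so the average distance is about \<open>ln n / n\<close>. Altogether
  \<open>\<sigma> * H\<close> is about \<open>(exp \<sigma> - 1) * ln n\<close>, and \<open>\<sigma>\<close> may tend to \<open>0\<close> slowly.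
\<close>

section \<open>Uniform weights\<close>

lemma sets_uniform01 [measurable_cong]: "sets uniform01 = sets borel"
  by (simp add: uniform01_def)

lemma space_uniform01 [simp]: "space uniform01 = UNIV"
  by (simp add: uniform01_def)

lemma nn_integral_uniform01:
  assumes [measurable]: "f \<in> borel_measurable borel"
  shows "(\<integral>\<^sup>+x. f x \<partial>uniform01) = (\<integral>\<^sup>+x. f x * indicator {0..1} x \<partial>lborel)"
  by (simp add: uniform01_def nn_integral_uniform_measure divide_ennreal_def)

lemma AE_uniform01: "AE x in uniform01. 0 \<le> x \<and> x \<le> 1"
  unfolding uniform01_def by (rule AE_uniform_measureI) auto

lemma AE_uniform01_neq: "AE x in uniform01. x \<noteq> (c::real)"
  unfolding uniform01_def by (rule AE_uniform_measureI) (use AE_lborel_singleton[of c] in auto)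

text \<open>The affine substitution carrying \<open>{0..1}\<close> onto \<open>{t..1}\<close> has
  Jacobian \<open>1 - t\<close>. It degenerates at \<open>t = 1\<close>, where both sides vanish
  because a single point has measure 0.\<close>

lemma nn_integral_uniform01_restrict:
  assumes [measurable]: "g \<in> borel_measurable borel" and t: "0 \<le> t" "t \<le> 1"
  shows "(\<integral>\<^sup>+x. g x * indicator {t..} x \<partial>uniform01)
    = ennreal (1 - t) * (\<integral>\<^sup>+x. g (t + (1 - t) * x) \<partial>uniform01)"
proof (cases "t = 1")
  case True
  have "(\<integral>\<^sup>+x. g x * indicator {1..} x \<partial>uniform01) = (\<integral>\<^sup>+x. 0 \<partial>uniform01)"
    by (rule nn_integral_cong_AE)
      (use AE_uniform01 AE_uniform01_neq[of 1] in eventually_elim, auto split: split_indicator)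
  then show ?thesis using True by simp
next
  case False
  have "(\<integral>\<^sup>+x. g x * indicator {t..} x \<partial>uniform01)
      = ennreal \<bar>1 - t\<bar> * (\<integral>\<^sup>+x. g (t + (1 - t) * x) * indicator {t..} (t + (1 - t) * x)
          * indicator {0..1} (t + (1 - t) * x) \<partial>lborel)"
    using False
    by (subst nn_integral_uniform01, simp, subst nn_integral_real_affine[where c = "1 - t" and t = t])
      simp_all
  also have "(\<integral>\<^sup>+x. g (t + (1 - t) * x) * indicator {t..} (t + (1 - t) * x)
          * indicator {0..1} (t + (1 - t) * x) \<partial>lborel)
      = (\<integral>\<^sup>+x. g (t + (1 - t) * x) * indicator {0..1} x \<partial>lborel)"
  proof (rule nn_integral_cong)
    fix x :: real
    have "t + (1 - t) * x \<le> 1 \<longleftrightarrow> (1 - t) * x \<le> (1 - t) * 1"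
      by (simp add: algebra_simps)
    then have *: "0 \<le> (1 - t) * x \<longleftrightarrow> 0 \<le> x" "t + (1 - t) * x \<le> 1 \<longleftrightarrow> x \<le> 1"
      using False t by (simp_all only: mult_le_cancel_left zero_le_mult_iff) auto
    show "g (t + (1 - t) * x) * indicator {t..} (t + (1 - t) * x)
          * indicator {0..1} (t + (1 - t) * x) = g (t + (1 - t) * x) * indicator {0..1} x"
      using * t by (cases "0 \<le> x") (auto simp: indicator_def)
  qed
  also have "\<dots> = (\<integral>\<^sup>+x. g (t + (1 - t) * x) \<partial>uniform01)"
    by (simp add: nn_integral_uniform01)
  finally show ?thesis using t by simp
qed

section \<open>Explicit integrals against the uniform law\<close>

lemma nn_integral_uniform01_real:
  assumes "\<And>x. (F has_real_derivative f x) (at x)" "\<And>x. 0 \<le> x \<Longrightarrow> x \<le> 1 \<Longrightarrow> 0 \<le> f x"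
    and [measurable]: "f \<in> borel_measurable borel"
  shows "(\<integral>\<^sup>+x. ennreal (f x) \<partial>uniform01) = ennreal (F 1 - F 0)"
proof -
  have "(\<integral>\<^sup>+x. ennreal (f x) * indicator {0..1} x \<partial>lborel) = ennreal (F 1 - F 0)"
    by (rule nn_integral_FTC_Icc) (use assms in auto)
  then show ?thesis by (simp add: nn_integral_uniform01)
qed

lemma has_real_derivative_one_minus_power:
  "((\<lambda>x::real. - ((1 - x) ^ Suc m) / real (Suc m)) has_real_derivative (1 - x) ^ m) (at x)"
  by (rule DERIV_cong, (rule derivative_eq_intros refl | simp del: of_nat_Suc power_Suc)+)

lemma nn_integral_uniform01_power:
  "(\<integral>\<^sup>+x. ennreal ((1 - x) ^ m) \<partial>uniform01) = ennreal (1 / real (Suc m))"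
  using nn_integral_uniform01_real[OF has_real_derivative_one_minus_power, of m] by simp

text \<open>Since \<open>x * (1 - x) ^ m = (1 - x) ^ m - (1 - x) ^ Suc m\<close>, an antiderivative
  is a difference of two known ones. Up to the factor \<open>Suc m\<close> this is the mean of the
  minimum of \<open>Suc m\<close> independent uniform weights.\<close>

lemma nn_integral_uniform01_times_power:
  "(\<integral>\<^sup>+x. ennreal (x * (1 - x) ^ m) \<partial>uniform01) = ennreal (1 / (real (Suc m) * real (Suc (Suc m))))"
proof -
  let ?F = "\<lambda>m x::real. - ((1 - x) ^ Suc m) / real (Suc m)"
  have "((\<lambda>x. ?F m x - ?F (Suc m) x) has_real_derivative x * (1 - x) ^ m) (at x)" for x
    by (rule has_real_derivative_one_minus_power[of m, THEN DERIV_diff,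
          OF has_real_derivative_one_minus_power[of "Suc m"], THEN DERIV_cong])
      (simp add: algebra_simps)
  then have "(\<integral>\<^sup>+x. ennreal (x * (1 - x) ^ m) \<partial>uniform01)
      = ennreal ((?F m 1 - ?F (Suc m) 1) - (?F m 0 - ?F (Suc m) 0))"
    by (rule nn_integral_uniform01_real) auto
  also have "(?F m 1 - ?F (Suc m) 1) - (?F m 0 - ?F (Suc m) 0)
      = 1 / real (Suc m) - 1 / real (Suc (Suc m))"
    by simp
  also have "\<dots> = 1 / (real (Suc m) * real (Suc (Suc m)))"
    by (simp add: field_simps)
  finally show ?thesis .
qed

lemma nn_integral_uniform01_exp_le:
  assumes "l > 0"
  shows "(\<integral>\<^sup>+x. ennreal (exp (- (l * x))) \<partial>uniform01) \<le> ennreal (1 / l)"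
proof (subst nn_integral_uniform01)
  have "(\<integral>\<^sup>+x. ennreal (exp (- (l * x))) * indicator {0..1} x \<partial>lborel)
    = ennreal (- exp (- (l * 1)) / l - - exp (- (l * 0)) / l)"
    by (rule nn_integral_FTC_Icc) (use assms in \<open>auto intro!: derivative_eq_intros\<close>)
  also have "\<dots> \<le> ennreal (1 / l)"
    using assms by (intro ennreal_leI) (simp add: field_simps)
  finally show "(\<integral>\<^sup>+x. ennreal (exp (- (l * x))) * indicator {0..1} x \<partial>lborel) \<le> ennreal (1 / l)" .
qed auto

interpretation unif: product_prob_space "\<lambda>_ :: 'i. uniform01" I for I
  by (rule product_prob_spaceI) (rule prob_space_uniform01)

section \<open>The minimum of independent uniform weights\<close>

text \<open>By Fubini the old coordinate \<open>i\<close> is integrated out trivially, because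
  \<open>w(i := x)\<close> overwrites it. This makes the updated weights equal in law to the
  original ones, and it also serves to exhibit null sets.\<close>

lemma nn_integral_PiM_uniform01_resample:
  assumes I: "finite I" "i \<in> I" and [measurable]: "f \<in> borel_measurable (\<Pi>\<^sub>M i\<in>I. uniform01)"
  shows "(\<integral>\<^sup>+w. (\<integral>\<^sup>+x. f (w(i := x)) \<partial>uniform01) \<partial>(\<Pi>\<^sub>M i\<in>I. uniform01))
    = (\<integral>\<^sup>+w. f w \<partial>(\<Pi>\<^sub>M i\<in>I. uniform01))"
proof -
  define J where "J = I - {i}"
  have J: "I = insert i J" "i \<notin> J" "finite J" using I by (auto simp: J_def)
  have f: "f \<in> borel_measurable (\<Pi>\<^sub>M i\<in>insert i J. uniform01)"
    using J(1) assms(3) by simp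
  note f[measurable]
  have m: "(\<lambda>(w, x). w(i := x)) \<in> (\<Pi>\<^sub>M i\<in>insert i J. uniform01) \<Otimes>\<^sub>M uniform01 \<rightarrow>\<^sub>M (\<Pi>\<^sub>M i\<in>insert i J. uniform01)"
    unfolding case_prod_beta by (rule measurable_fun_upd[where J = "insert i J"]) (use J in auto)
  have m': "(\<lambda>(w, x). f (w(i := x))) \<in> borel_measurable ((\<Pi>\<^sub>M i\<in>insert i J. uniform01) \<Otimes>\<^sub>M uniform01)"
    using measurable_compose[OF m f] by (simp add: case_prod_beta)
  have "(\<integral>\<^sup>+w. (\<integral>\<^sup>+x. f (w(i := x)) \<partial>uniform01) \<partial>(\<Pi>\<^sub>M i\<in>insert i J. uniform01))
      = (\<integral>\<^sup>+w. (\<integral>\<^sup>+x. f (w(i := x)) \<partial>uniform01) \<partial>(\<Pi>\<^sub>M i\<in>J. uniform01))"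
    using m' by (subst unif.product_nn_integral_insert[OF J(3,2)])
      (auto intro: sigma_finite_measure.borel_measurable_nn_integral[OF prob_space_imp_sigma_finite[OF prob_space_uniform01]] simp: prob_space.emeasure_space_1[OF prob_space_uniform01, simplified])
  also have "\<dots> = (\<integral>\<^sup>+w. f w \<partial>(\<Pi>\<^sub>M i\<in>insert i J. uniform01))"
    by (subst unif.product_nn_integral_insert[OF J(3,2)]) auto
  finally show ?thesis using J(1) by simp
qed

text \<open>
  Conditioned on exceeding \<open>t\<close>, a uniform variable \<open>x\<close> has the law of \<open>t + (1 - t) * x\<close>; this
  takes the place of the memoryless property of exponential weights.
\<close>

definition rescale :: "real \<Rightarrow> 'i set \<Rightarrow> ('i \<Rightarrow> real) \<Rightarrow> 'i \<Rightarrow> real" where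
  "rescale t B w = (\<lambda>i. if i \<in> B then t + (1 - t) * w i else w i)"

lemma rescale_rescale: "b \<notin> B \<Longrightarrow> rescale t B (rescale t {b} w) = rescale t (insert b B) w"
  by (auto simp: rescale_def)

lemma measurable_rescale [measurable]:
  assumes "B \<subseteq> J"
  shows "rescale t B \<in> (\<Pi>\<^sub>M i\<in>J. uniform01) \<rightarrow>\<^sub>M (\<Pi>\<^sub>M i\<in>J. uniform01)"
  unfolding rescale_def[abs_def]
  by (rule measurable_PiM_single')
    (use assms in \<open>auto simp: space_PiM PiE_iff extensional_def\<close>)

lemma nn_integral_PiM_uniform01_restrict1:
  assumes J: "finite J" "b \<in> J" and f: "f \<in> borel_measurable (\<Pi>\<^sub>M i\<in>J. uniform01)"
    and t: "0 \<le> t" "t \<le> 1"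
  shows "(\<integral>\<^sup>+w. f w * indicator {t..} (w b) \<partial>(\<Pi>\<^sub>M i\<in>J. uniform01))
    = ennreal (1 - t) * (\<integral>\<^sup>+w. f (rescale t {b} w) \<partial>(\<Pi>\<^sub>M i\<in>J. uniform01))"
proof -
  define K where "K = J - {b}"
  have K: "J = insert b K" "b \<notin> K" "finite K" using J by (auto simp: K_def)
  note f[unfolded K(1), measurable]
  have [measurable]: "rescale t {b} \<in> (\<Pi>\<^sub>M i\<in>insert b K. uniform01) \<rightarrow>\<^sub>M (\<Pi>\<^sub>M i\<in>insert b K. uniform01)"
    by (rule measurable_rescale) auto
  have upd: "rescale t {b} (w(b := x)) = w(b := t + (1 - t) * x)" for w x
    by (auto simp: rescale_def)
  have m: "(\<lambda>x. w(b := x)) \<in> uniform01 \<rightarrow>\<^sub>M (\<Pi>\<^sub>M i\<in>insert b K. uniform01)"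
    if "w \<in> space (\<Pi>\<^sub>M i\<in>K. uniform01)" for w
    by (rule measurable_fun_upd[where J = K]) (use that in auto)
  have "(\<integral>\<^sup>+w. f w * indicator {t..} (w b) \<partial>(\<Pi>\<^sub>M i\<in>insert b K. uniform01))
      = (\<integral>\<^sup>+w. (\<integral>\<^sup>+x. f (w(b := x)) * indicator {t..} x \<partial>uniform01) \<partial>(\<Pi>\<^sub>M i\<in>K. uniform01))"
    by (subst unif.product_nn_integral_insert[OF K(3,2)]) auto
  also have "\<dots> = (\<integral>\<^sup>+w. ennreal (1 - t) * (\<integral>\<^sup>+x. f (rescale t {b} (w(b := x))) \<partial>uniform01) \<partial>(\<Pi>\<^sub>M i\<in>K. uniform01))"
  proof (rule nn_integral_cong)
    fix w assume w: "w \<in> space (\<Pi>\<^sub>M i\<in>K. uniform01)"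
    have "(\<lambda>x. f (w(b := x))) \<in> borel_measurable borel"
      using measurable_compose[OF m[OF w], of f] by (simp add: measurable_cong_sets[OF sets_uniform01 refl])
    then show "(\<integral>\<^sup>+x. f (w(b := x)) * indicator {t..} x \<partial>uniform01)
        = ennreal (1 - t) * (\<integral>\<^sup>+x. f (rescale t {b} (w(b := x))) \<partial>uniform01)"
      unfolding upd by (rule nn_integral_uniform01_restrict) (use t in auto)
  qed
  also have "\<dots> = ennreal (1 - t) * (\<integral>\<^sup>+w. (\<integral>\<^sup>+x. f (rescale t {b} (w(b := x))) \<partial>uniform01) \<partial>(\<Pi>\<^sub>M i\<in>K. uniform01))"
    by (rule nn_integral_cmult) measurable
  also have "\<dots> = ennreal (1 - t) * (\<integral>\<^sup>+w. f (rescale t {b} w) \<partial>(\<Pi>\<^sub>M i\<in>insert b K. uniform01))"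
    by (subst unif.product_nn_integral_insert[OF K(3,2)]) auto
  finally show ?thesis using K(1) by simp
qed

text \<open>Coordinates are conditioned one at a time: rescaling those in \<open>B\<close> leaves a
  coordinate \<open>b\<close> outside \<open>B\<close> untouched, so each one contributes its own
  factor \<open>1 - t\<close>.\<close>

lemma nn_integral_PiM_uniform01_restrict:
  assumes J: "finite J" and B: "B \<subseteq> J" and f: "f \<in> borel_measurable (\<Pi>\<^sub>M i\<in>J. uniform01)"
    and t: "0 \<le> t" "t \<le> 1"
  shows "(\<integral>\<^sup>+w. f w * (\<Prod>b\<in>B. indicator {t..} (w b)) \<partial>(\<Pi>\<^sub>M i\<in>J. uniform01))
    = ennreal ((1 - t) ^ card B) * (\<integral>\<^sup>+w. f (rescale t B w) \<partial>(\<Pi>\<^sub>M i\<in>J. uniform01))"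
proof -
  have "finite B" using B J by (rule finite_subset)
  then show ?thesis using B f
  proof (induction B arbitrary: f)
    case empty
    then show ?case by (simp add: rescale_def)
  next
    case (insert b B)
    note insert.prems(2)[measurable]
    have [measurable]: "rescale t B \<in> (\<Pi>\<^sub>M i\<in>J. uniform01) \<rightarrow>\<^sub>M (\<Pi>\<^sub>M i\<in>J. uniform01)" and b: "b \<in> J"
      using insert.prems(1) by (auto intro: measurable_rescale)
    have "(\<integral>\<^sup>+w. f w * (\<Prod>b\<in>insert b B. indicator {t..} (w b)) \<partial>(\<Pi>\<^sub>M i\<in>J. uniform01))
        = (\<integral>\<^sup>+w. (f w * indicator {t..} (w b)) * (\<Prod>b\<in>B. indicator {t..} (w b)) \<partial>(\<Pi>\<^sub>M i\<in>J. uniform01))"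
      using insert.hyps by (simp add: mult.assoc)
    also have "\<dots> = ennreal ((1 - t) ^ card B)
        * (\<integral>\<^sup>+w. f (rescale t B w) * indicator {t..} (rescale t B w b) \<partial>(\<Pi>\<^sub>M i\<in>J. uniform01))"
      using insert.prems(1) b by (intro insert.IH) auto
    also have "(\<integral>\<^sup>+w. f (rescale t B w) * indicator {t..} (rescale t B w b) \<partial>(\<Pi>\<^sub>M i\<in>J. uniform01))
        = (\<integral>\<^sup>+w. f (rescale t B w) * indicator {t..} (w b) \<partial>(\<Pi>\<^sub>M i\<in>J. uniform01))"
      using insert.hyps by (simp add: rescale_def)
    also have "\<dots> = ennreal (1 - t) * (\<integral>\<^sup>+w. f (rescale t B (rescale t {b} w)) \<partial>(\<Pi>\<^sub>M i\<in>J. uniform01))"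
      by (rule nn_integral_PiM_uniform01_restrict1[OF J b _ t]) measurable
    finally show ?case
      using insert.hyps t by (simp add: rescale_rescale ennreal_mult' mult_ac)
  qed
qed

text \<open>
  Sums over the coordinate \<open>a \<in> A\<close> at which the minimum over \<open>A\<close> is attained; ties are counted
  several times, hence only an inequality.
\<close>

lemma nn_integral_PiM_uniform01_min_le:
  assumes I: "finite I" and A: "A \<subseteq> I" "A \<noteq> {}" and f: "f \<in> borel_measurable (\<Pi>\<^sub>M i\<in>I. uniform01)"
  shows "(\<integral>\<^sup>+w. f w \<partial>(\<Pi>\<^sub>M i\<in>I. uniform01))
    \<le> (\<Sum>a\<in>A. \<integral>\<^sup>+t. ennreal ((1 - t) ^ (card A - 1))
        * (\<integral>\<^sup>+w. f ((rescale t (A - {a}) w)(a := t)) \<partial>(\<Pi>\<^sub>M i\<in>I. uniform01)) \<partial>uniform01)"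
proof -
  note f[measurable]
  have fin: "finite A" using A I by (blast intro: finite_subset)
  let ?P = "\<Pi>\<^sub>M i\<in>I. uniform01"
  have mP: "(\<lambda>w. f w * (\<Prod>b\<in>A - {a}. indicator {w a..} (w b))) \<in> borel_measurable ?P" if a: "a \<in> A" for a
  proof (intro borel_measurable_times_ennreal borel_measurable_prod_ennreal f)
    fix b assume "b \<in> A - {a}"
    then have [measurable]: "(\<lambda>w. w a) \<in> borel_measurable ?P" "(\<lambda>w. w b) \<in> borel_measurable ?P"
      using a A(1) measurable_component_singleton[of _ I "\<lambda>_. uniform01"]
      by (auto simp: measurable_cong_sets[OF refl sets_uniform01])
    have "(\<lambda>w. if w a \<le> w b then 1 else 0 :: ennreal) \<in> borel_measurable ?P" by measurable
    then show "(\<lambda>w. indicator {w a..} (w b) :: ennreal) \<in> borel_measurable ?P"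
      by (simp add: indicator_def of_bool_def)
  qed
  have "(\<integral>\<^sup>+w. f w \<partial>?P) \<le> (\<integral>\<^sup>+w. (\<Sum>a\<in>A. f w * (\<Prod>b\<in>A - {a}. indicator {w a..} (w b))) \<partial>?P)"
  proof (rule nn_integral_mono)
    fix w :: "'a \<Rightarrow> real"
    define a where "a = arg_min_on w A"
    have a: "a \<in> A" "\<And>b. b \<in> A \<Longrightarrow> w a \<le> w b"
      unfolding a_def using fin A(2) arg_min_if_finite(1)[of A w] arg_min_least[of A _ w] by auto
    \<comment> \<open>A minimiser satisfies all the inequalities, so its summand alone already
      equals \<open>f w\<close>.\<close>
    have "f w = f w * (\<Prod>b\<in>A - {a}. indicator {w a..} (w b))"
      using a by simp
    also have "\<dots> \<le> (\<Sum>a\<in>A. f w * (\<Prod>b\<in>A - {a}. indicator {w a..} (w b)))"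
      by (rule member_le_sum) (use a fin in auto)
    finally show "f w \<le> \<dots>" .
  qed
  also have "\<dots> = (\<Sum>a\<in>A. \<integral>\<^sup>+w. f w * (\<Prod>b\<in>A - {a}. indicator {w a..} (w b)) \<partial>?P)"
    by (rule nn_integral_sum) (rule mP)
  also have "\<dots> = (\<Sum>a\<in>A. \<integral>\<^sup>+t. ennreal ((1 - t) ^ (card A - 1))
        * (\<integral>\<^sup>+w. f ((rescale t (A - {a}) w)(a := t)) \<partial>?P) \<partial>uniform01)"
  proof (rule sum.cong[OF refl])
    fix a assume a: "a \<in> A"
    define J where "J = I - {a}"
    have J: "I = insert a J" "a \<notin> J" "finite J" using I A a by (auto simp: J_def)
    have AJ: "A - {a} \<subseteq> J" using A by (auto simp: J_def)
    let ?Q = "\<Pi>\<^sub>M i\<in>J. uniform01"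
    note f[unfolded J(1), measurable]
    have [measurable]: "(\<lambda>w. w(a := t)) \<in> ?Q \<rightarrow>\<^sub>M (\<Pi>\<^sub>M i\<in>insert a J. uniform01)" for t
      by (rule measurable_fun_upd[where J = J]) auto
    have [measurable]: "(\<lambda>w. w(a := t)) \<in> (\<Pi>\<^sub>M i\<in>insert a J. uniform01) \<rightarrow>\<^sub>M (\<Pi>\<^sub>M i\<in>insert a J. uniform01)" for t
      by (rule measurable_fun_upd[where J = "insert a J"]) auto
    have [measurable]: "rescale t (A - {a}) \<in> (\<Pi>\<^sub>M i\<in>insert a J. uniform01) \<rightarrow>\<^sub>M (\<Pi>\<^sub>M i\<in>insert a J. uniform01)" for t
      by (rule measurable_rescale) (use AJ in auto)
    \<comment> \<open>The coordinate \<open>a\<close> becomes the outer variable \<open>t\<close>;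
      for fixed \<open>t\<close> the other coordinates in \<open>A\<close> are restricted to values
      of at least \<open>t\<close>.\<close>
    have "(\<integral>\<^sup>+w. f w * (\<Prod>b\<in>A - {a}. indicator {w a..} (w b)) \<partial>?P)
        = (\<integral>\<^sup>+t. (\<integral>\<^sup>+w. f (w(a := t)) * (\<Prod>b\<in>A - {a}. indicator {(w(a := t)) a..} ((w(a := t)) b)) \<partial>?Q) \<partial>uniform01)"
      unfolding J(1)
      by (rule unif.product_nn_integral_insert_rev[OF J(3,2) mP[OF a, unfolded J(1)]])
    also have "\<dots> = (\<integral>\<^sup>+t. (\<integral>\<^sup>+w. f (w(a := t)) * (\<Prod>b\<in>A - {a}. indicator {t..} (w b)) \<partial>?Q) \<partial>uniform01)"
      by simp
    also have "\<dots> = (\<integral>\<^sup>+t. ennreal ((1 - t) ^ (card A - 1))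
        * (\<integral>\<^sup>+w. f ((rescale t (A - {a}) w)(a := t)) \<partial>?P) \<partial>uniform01)"
    proof (rule nn_integral_cong_AE, use AE_uniform01 in eventually_elim)
      fix t :: real assume t: "0 \<le> t \<and> t \<le> 1"
      have "(\<integral>\<^sup>+w. f (w(a := t)) * (\<Prod>b\<in>A - {a}. indicator {t..} (w b)) \<partial>?Q)
          = ennreal ((1 - t) ^ (card A - 1)) * (\<integral>\<^sup>+w. f ((rescale t (A - {a}) w)(a := t)) \<partial>?Q)"
        by (subst nn_integral_PiM_uniform01_restrict[OF J(3) AJ, of "\<lambda>w. f (w(a := t))" t])
          (use t a fin in auto)
      \<comment> \<open>The coordinate \<open>a\<close> is overwritten by \<open>t\<close>, so it
        may be put back as an independent dummy; all summands then refer to the same product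
        measure.\<close>
      also have "(\<integral>\<^sup>+w. f ((rescale t (A - {a}) w)(a := t)) \<partial>?Q)
          = (\<integral>\<^sup>+w. f ((rescale t (A - {a}) w)(a := t)) \<partial>?P)"
      proof -
        have *: "(rescale t (A - {a}) (w(a := y)))(a := t) = (rescale t (A - {a}) w)(a := t)" for w y
          by (auto simp: rescale_def)
        show ?thesis
          unfolding J(1) by (subst unif.product_nn_integral_insert[OF J(3,2)])
            (auto simp: * prob_space.emeasure_space_1[OF prob_space_uniform01, simplified])
      qed
      finally show "(\<integral>\<^sup>+w. f (w(a := t)) * (\<Prod>b\<in>A - {a}. indicator {t..} (w b)) \<partial>?Q)
          = ennreal ((1 - t) ^ (card A - 1)) * (\<integral>\<^sup>+w. f ((rescale t (A - {a}) w)(a := t)) \<partial>?P)" .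
    qed
    finally show "(\<integral>\<^sup>+w. f w * (\<Prod>b\<in>A - {a}. indicator {w a..} (w b)) \<partial>?P)
        = (\<integral>\<^sup>+t. ennreal ((1 - t) ^ (card A - 1))
        * (\<integral>\<^sup>+w. f ((rescale t (A - {a}) w)(a := t)) \<partial>?P) \<partial>uniform01)" .
  qed
  finally show ?thesis .
qed

text \<open>The engine of one greedy step. The minimum \<open>t\<close> over \<open>A\<close> has
  mean \<open>1 / (card A + 1)\<close> and is charged at rate \<open>c\<close>. Once it is exposed,
  the rescaled remaining weights are expressed by independent uniform ones again, so the rest is
  bounded by an ordinary integral of \<open>g a\<close>.\<close>

lemma nn_integral_PiM_uniform01_min_step:
  assumes I: "finite I" and A: "A \<subseteq> I" "A \<noteq> {}" and f: "f \<in> borel_measurable (\<Pi>\<^sub>M i\<in>I. uniform01)"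
    and g: "\<And>a. a \<in> A \<Longrightarrow> g a \<in> borel_measurable (\<Pi>\<^sub>M i\<in>I. uniform01)"
    and le: "\<And>a t w. a \<in> A \<Longrightarrow> 0 \<le> t \<Longrightarrow> t \<le> 1 \<Longrightarrow>
      f ((rescale t (A - {a}) w)(a := t)) \<le> c * ennreal t + g a w"
    and K: "\<And>a. a \<in> A \<Longrightarrow> (\<integral>\<^sup>+w. g a w \<partial>(\<Pi>\<^sub>M i\<in>I. uniform01)) \<le> K"
  shows "(\<integral>\<^sup>+w. f w \<partial>(\<Pi>\<^sub>M i\<in>I. uniform01)) \<le> c * ennreal (1 / (card A + 1)) + K"
proof -
  let ?P = "\<Pi>\<^sub>M i\<in>I. uniform01"
  define m where "m = card A - 1"
  have "card A > 0" using A I by (auto simp: card_gt_0_iff intro: finite_subset)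
  then have cA: "card A = Suc m" by (simp add: m_def)
  have "(\<integral>\<^sup>+w. f w \<partial>?P) \<le> (\<Sum>a\<in>A. \<integral>\<^sup>+t. ennreal ((1 - t) ^ m)
        * (\<integral>\<^sup>+w. f ((rescale t (A - {a}) w)(a := t)) \<partial>?P) \<partial>uniform01)"
    unfolding m_def by (rule nn_integral_PiM_uniform01_min_le[OF I A f])
  also have "\<dots> \<le> (\<Sum>a\<in>A. \<integral>\<^sup>+t. c * ennreal (t * (1 - t) ^ m) + ennreal ((1 - t) ^ m) * K \<partial>uniform01)"
  proof (rule sum_mono, rule nn_integral_mono_AE, use AE_uniform01 in eventually_elim)
    fix a and t :: real assume a: "a \<in> A" and t: "0 \<le> t \<and> t \<le> 1"
    note g[OF a, measurable]
    have "(\<integral>\<^sup>+w. f ((rescale t (A - {a}) w)(a := t)) \<partial>?P) \<le> (\<integral>\<^sup>+w. c * ennreal t + g a w \<partial>?P)"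
      by (rule nn_integral_mono) (use le a t in auto)
    also have "\<dots> = c * ennreal t + (\<integral>\<^sup>+w. g a w \<partial>?P)"
      by (subst nn_integral_add) (auto simp: prob_space.emeasure_space_1[OF prob_space_PiM[OF prob_space_uniform01]])
    also have "\<dots> \<le> c * ennreal t + K" using K[OF a] by (rule add_left_mono)
    finally have "ennreal ((1 - t) ^ m) * (\<integral>\<^sup>+w. f ((rescale t (A - {a}) w)(a := t)) \<partial>?P)
        \<le> ennreal ((1 - t) ^ m) * (c * ennreal t + K)" by (rule mult_left_mono) auto
    also have "\<dots> = c * ennreal (t * (1 - t) ^ m) + ennreal ((1 - t) ^ m) * K"
      using t by (simp add: distrib_left ennreal_mult' mult_ac)
    finally show "ennreal ((1 - t) ^ m) * (\<integral>\<^sup>+w. f ((rescale t (A - {a}) w)(a := t)) \<partial>?P) \<le> \<dots>" .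
  qed
  also have "\<dots> = (\<Sum>a\<in>A. c * ennreal (1 / (real (Suc m) * real (Suc (Suc m)))) + ennreal (1 / real (Suc m)) * K)"
    by (subst nn_integral_add)
      (simp_all add: nn_integral_cmult nn_integral_multc nn_integral_uniform01_power
        nn_integral_uniform01_times_power del: of_nat_Suc)
  \<comment> \<open>All \<open>Suc m\<close> positions of the minimum contribute the same amount,
    which cancels one factor \<open>1 / Suc m\<close> in each term.\<close>
  also have "\<dots> = c * (ennreal (real (Suc m)) * ennreal (1 / (real (Suc m) * real (Suc (Suc m)))))
      + ennreal (real (Suc m)) * ennreal (1 / real (Suc m)) * K"
    by (simp add: cA distrib_left mult_ac ennreal_of_nat_eq_real_of_nat del: of_nat_Suc)
  also have "ennreal (real (Suc m)) * ennreal (1 / (real (Suc m) * real (Suc (Suc m)))) = ennreal (1 / (card A + 1))"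
    by (subst ennreal_mult[symmetric]) (simp_all add: cA)
  also have "ennreal (real (Suc m)) * ennreal (1 / real (Suc m)) = 1"
    by (subst ennreal_mult[symmetric]) simp_all
  finally show ?thesis by simp
qed

section \<open>Paths and distances in the complete digraph\<close>

interpretation Kn: graph "Kn n" for n
  using complete_digraph_Kn unfolding complete_digraph_def by blast

lemma Kn_sel [simp]: "verts (Kn n) = {..<n}" "tail (Kn n) = fst" "head (Kn n) = snd"
  by (simp_all add: Kn_def)

lemma in_arcs_Kn: "a \<in> arcs (Kn n) \<longleftrightarrow> fst a < n \<and> snd a < n \<and> fst a \<noteq> snd a"
  by (auto simp: Kn_def)

text \<open>The vertices visited by a walk are its start followed by the heads of its arcs, so
  simplicity can be read off the list of arcs.\<close>

lemma apath_Kn_iff: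
  "Kn.apath n u p v \<longleftrightarrow> u < n \<and> set p \<subseteq> arcs (Kn n) \<and> Kn.cas n u p v \<and> distinct (u # map snd p)"
proof -
  have "distinct (Kn.awalk_verts n u p) \<longleftrightarrow> distinct (u # map snd p)" if "Kn.cas n u p v"
  proof (cases p)
    case (Cons a q)
    then have "fst a = u" using that by simp
    then show ?thesis
      using Kn.awalk_verts_conv'[OF that] Cons by simp
  qed simp
  then show ?thesis
    by (auto simp: Kn.apath_def Kn.awalk_def)
qed

lemma cas_Kn_tails: "Kn.cas n u p v \<Longrightarrow> fst ` set p \<subseteq> insert u (snd ` set p)"
  by (induction p arbitrary: u) fastforce+

lemma cas_Kn_ends: "Kn.cas n u p v \<Longrightarrow> p \<noteq> [] \<Longrightarrow> fst (hd p) = u \<and> snd (last p) = v"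
  by (induction p arbitrary: u) auto

lemma cas_Kn_zip: "Kn.cas n u p v \<Longrightarrow> p = zip (u # map snd p) (map snd p)"
  by (induction p arbitrary: u) auto

lemma apath_Kn_nonempty: "Kn.apath n u p v \<Longrightarrow> u \<noteq> v \<Longrightarrow> p \<noteq> []"
  by (auto simp: apath_Kn_iff)

lemma apath_Kn_distinct: "Kn.apath n u p v \<Longrightarrow> distinct p"
  by (auto simp: apath_Kn_iff distinct_map)

text \<open>A path never returns to its start, so only its first arc leaves from there; the rest is
  a path from the next vertex.\<close>

lemma apath_Kn_inj_tail:
  assumes "Kn.cas n u p v" "distinct (u # map snd p)"
  shows "inj_on fst (set p)"
  using assms
proof (induction p arbitrary: u)
  case (Cons a p)
  have "fst ` set p \<subseteq> insert (snd a) (snd ` set p)"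
    using cas_Kn_tails[of n "snd a" p v] Cons.prems by simp
  then have "u \<notin> fst ` set p"
    using Cons.prems by auto
  moreover have "inj_on fst (set p)" using Cons by auto
  ultimately show ?case using Cons.prems by auto
qed auto

text \<open>Since \<open>q\<close> leaves each vertex at most once, following both paths from
  \<open>u\<close> shows that every arc of \<open>p\<close> is the current arc of \<open>q\<close>.
  Contrapositively, distinct paths with common ends each have an arc that the other lacks, which
  drives almost sure uniqueness.\<close>

lemma apath_Kn_eqI:
  assumes p: "Kn.apath n u p v" and q: "Kn.apath n u q v" and sub: "set p \<subseteq> set q"
  shows "p = q"
proof -
  have "p = q" if "Kn.cas n u p v" "Kn.cas n u q v" "distinct (u # map snd p)" "distinct (u # map snd q)"
    "set p \<subseteq> set q" for u p q
    using that
  proof (induction p arbitrary: u q)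
    case Nil
    then have "u = v" by simp
    \<comment> \<open>A nonempty \<open>q\<close> would end at its own start, repeating that
      vertex.\<close>
    then have "q = []"
      using Nil cas_Kn_ends[of n u q v] by (metis distinct.simps(2) image_eqI last_in_set set_map)
    then show ?case by simp
  next
    case (Cons a p)
    have "q \<noteq> []" using Cons.prems(5) by auto
    then obtain b r where q: "q = b # r" by (cases q) auto
    have inj: "inj_on fst (set q)" using apath_Kn_inj_tail Cons.prems(2,4) by blast
    have "fst a = fst b" "a \<in> set q" "b \<in> set q" using Cons.prems q by auto
    then have ab: "a = b" using inj by (auto dest: inj_onD)
    have "a \<notin> set p" using Cons.prems(3) by auto
    then have "set p \<subseteq> set r" using Cons.prems(5) q ab by auto
    then have "p = r" using Cons.IH[of "snd a" r] Cons.prems q ab by auto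
    then show ?case using q ab by simp
  qed
  then show ?thesis using p q sub unfolding apath_Kn_iff by blast
qed

section \<open>Counting paths between distinct vertices\<close>

definition Kn_paths :: "nat \<Rightarrow> (nat \<times> nat) list set" where
  "Kn_paths n = {p. \<exists>u v. u \<noteq> v \<and> Kn.apath n u p v}"

text \<open>A path is recovered by pairing consecutive entries of its vertex sequence; being
  nonempty, it has a first arc that supplies the start. Paths with \<open>k\<close> arcs thus inject
  into lists of \<open>k + 1\<close> vertices.\<close>

lemma inj_on_Kn_paths_verts:
  "inj_on (\<lambda>p. fst (hd p) # map snd p) (Kn_paths n)"
proof (rule inj_onI)
  fix p q assume *: "p \<in> Kn_paths n" "q \<in> Kn_paths n" "fst (hd p) # map snd p = fst (hd q) # map snd q"
  have "r = zip (fst (hd r) # map snd r) (map snd r)" if r: "r \<in> Kn_paths n" for r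
  proof -
    obtain u v where "u \<noteq> v" "Kn.apath n u r v" using r by (auto simp: Kn_paths_def)
    then have "fst (hd r) = u" "r = zip (u # map snd r) (map snd r)"
      using cas_Kn_ends cas_Kn_zip apath_Kn_nonempty unfolding apath_Kn_iff by blast+
    then show ?thesis by simp
  qed
  then show "p = q" using * by (metis list.inject)
qed

lemma card_Kn_paths_length:
  "finite {p \<in> Kn_paths n. length p = k} \<and> card {p \<in> Kn_paths n. length p = k} \<le> n ^ (k + 1)"
proof -
  let ?f = "\<lambda>p :: (nat \<times> nat) list. fst (hd p) # map snd p"
  let ?L = "{xs. set xs \<subseteq> {..<n} \<and> length xs = k + 1}"
  have fin: "finite ?L" by (rule finite_lists_length_eq) auto
  have sub: "?f ` {p \<in> Kn_paths n. length p = k} \<subseteq> ?L"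
  proof clarsimp
    fix p assume p: "p \<in> Kn_paths n"
    then have "p \<noteq> []" "set p \<subseteq> arcs (Kn n)"
      using apath_Kn_nonempty by (auto simp: Kn_paths_def apath_Kn_iff)
    then have "hd p \<in> arcs (Kn n)" "\<forall>a\<in>set p. a \<in> arcs (Kn n)"
      using hd_in_set by blast+
    then show "fst (hd p) < n \<and> snd ` set p \<subseteq> {..<n}"
      by (auto simp: in_arcs_Kn)
  qed
  have inj: "inj_on ?f {p \<in> Kn_paths n. length p = k}"
    by (rule inj_on_subset[OF inj_on_Kn_paths_verts]) auto
  have "card {p \<in> Kn_paths n. length p = k} \<le> card ?L"
    by (rule card_inj_on_le[OF inj sub fin])
  also have "card ?L = n ^ (k + 1)"
    by (subst card_lists_length_eq) auto
  finally show ?thesis using inj_on_finite[OF inj sub fin] by simp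
qed

lemma length_Kn_paths:
  assumes "p \<in> Kn_paths n"
  shows "length p < n" "p \<noteq> []"
proof -
  obtain u v where p: "u \<noteq> v" "Kn.apath n u p v" using assms by (auto simp: Kn_paths_def)
  then show "p \<noteq> []" using apath_Kn_nonempty by blast
  have "distinct (u # map snd p)" "set (u # map snd p) \<subseteq> {..<n}"
    using p(2) by (auto simp: apath_Kn_iff in_arcs_Kn subset_iff)
  then have "length (u # map snd p) \<le> card {..<n}"
    by (metis card_mono distinct_card finite_lessThan)
  then show "length p < n" by simp
qed

lemma finite_Kn_paths: "finite (Kn_paths n)"
proof -
  have "Kn_paths n = (\<Union>k\<in>{..<n}. {p \<in> Kn_paths n. length p = k})"
    using length_Kn_paths by auto
  also have "finite \<dots>" using card_Kn_paths_length by blast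
  finally show ?thesis .
qed

section \<open>Distances from a growing vertex set\<close>

text \<open>
  Since a path may not return to \<open>S\<close>, the distance depends on no arc ending in \<open>S\<close> and, among the
  arcs leaving \<open>S\<close>, only on those crossing to the complement. This independence is what drives
  the recursion over growing \<open>S\<close>. The coercion \<open>ennreal\<close> truncates negative weights at \<open>0\<close>.
\<close>

definition set_dist :: "nat \<Rightarrow> nat set \<Rightarrow> (nat \<times> nat \<Rightarrow> real) \<Rightarrow> nat \<Rightarrow> ennreal" where
  "set_dist n S w v = (INF p \<in> {p. \<exists>u\<in>S. Kn.apath n u p v \<and> snd ` set p \<inter> S = {}}.
    sum_list (map (\<lambda>a. ennreal (w a)) p))"

lemma set_dist_le:
  "u \<in> S \<Longrightarrow> Kn.apath n u p v \<Longrightarrow> snd ` set p \<inter> S = {}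
    \<Longrightarrow> set_dist n S w v \<le> sum_list (map (\<lambda>a. ennreal (w a)) p)"
  unfolding set_dist_def by (rule INF_lower) auto

lemma measurable_set_dist [measurable]:
  "(\<lambda>w. set_dist n S w v) \<in> borel_measurable (\<Pi>\<^sub>M a\<in>arcs (Kn n). uniform01)"
proof -
  have "(\<lambda>w. sum_list (map (\<lambda>a. ennreal (w a)) p)) \<in> borel_measurable (\<Pi>\<^sub>M a\<in>arcs (Kn n). uniform01)"
    if "set p \<subseteq> arcs (Kn n)" for p
    using that
  proof (induction p)
    case (Cons a p)
    then have [measurable]: "a \<in> arcs (Kn n)" by auto
    have [measurable]: "(\<lambda>w. sum_list (map (\<lambda>a. ennreal (w a)) p)) \<in> borel_measurable (\<Pi>\<^sub>M a\<in>arcs (Kn n). uniform01)"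
      using Cons by auto
    show ?case by simp
  qed simp
  then show ?thesis
    unfolding set_dist_def by (intro borel_measurable_INF) (auto simp: apath_Kn_iff)
qed

text \<open>\<open>w'\<close> describes the weights when \<open>(s, x)\<close> is the cheapest arc
  leaving \<open>S\<close>. A path starting at \<open>x\<close> is extended by \<open>(s, x)\<close>
  at cost \<open>t\<close>. A path starting in \<open>S\<close> begins with a crossing arc, whose
  rescaled weight adds at most \<open>t\<close>; its later arcs start outside \<open>S\<close> and
  keep their weights.\<close>

lemma set_dist_step:
  fixes w :: "nat \<times> nat \<Rightarrow> real"
  assumes s: "s \<in> S" "s < n" and x: "x \<notin> S" "x < n" and v: "v \<notin> insert x S"
    and t: "0 \<le> t" "t \<le> 1"
  defines "w' \<equiv> (rescale t (S \<times> ({..<n} - S) - {(s, x)}) w)((s, x) := t)"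
  shows "set_dist n S w' v \<le> ennreal t + set_dist n (insert x S) w v"
proof -
  have le: "set_dist n S w' v \<le> ennreal t + sum_list (map (\<lambda>a. ennreal (w a)) q)"
    if u: "u \<in> insert x S" and q: "Kn.apath n u q v" and qS: "snd ` set q \<inter> insert x S = {}" for u q
  proof -
    have unch: "w' a = w a" if "fst a \<notin> S" for a
      using that s by (auto simp: w'_def rescale_def)
    obtain b r where br: "q = b # r" using apath_Kn_nonempty[OF q] u v by (cases q) auto
    have b: "fst b = u" and cr: "Kn.cas n (snd b) r v" and qa: "set q \<subseteq> arcs (Kn n)"
      using q br by (auto simp: apath_Kn_iff)
    \<comment> \<open>Every later arc starts where an earlier one ended, and the path never enters
      \<open>S\<close>.\<close>
    have "fst ` set r \<subseteq> snd ` set q" using cas_Kn_tails[OF cr] br by auto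
    then have r: "map (\<lambda>a. ennreal (w' a)) r = map (\<lambda>a. ennreal (w a)) r"
      using qS by (intro map_cong refl arg_cong[where f = ennreal] unch) blast
    show ?thesis
    proof (cases "u = x")
      case True
      have "Kn.apath n s ((s, x) # q) v" "snd ` set ((s, x) # q) \<inter> S = {}"
        using q True s x qS by (auto simp: apath_Kn_iff in_arcs_Kn)
      then have "set_dist n S w' v \<le> sum_list (map (\<lambda>a. ennreal (w' a)) ((s, x) # q))"
        using s by (intro set_dist_le)
      also have "\<dots> = ennreal t + sum_list (map (\<lambda>a. ennreal (w a)) q)"
        using True b x by (simp add: br r unch) (simp add: w'_def)
      finally show ?thesis .
    next
      case False
      then have uS: "u \<in> S" using u by simp
      have "snd b \<in> {..<n} - S" "b \<noteq> (s, x)" using qa qS br by (auto simp: in_arcs_Kn)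
      then have wb: "w' b = t + (1 - t) * w b"
        using b uS by (auto simp: w'_def rescale_def mem_Times_iff)
      \<comment> \<open>The maximum with \<open>0\<close> mirrors the truncation by
        \<open>ennreal\<close>, since \<open>w\<close> is arbitrary here and may be
        negative.\<close>
      have "w' b \<le> t + max 0 (w b)"
      proof (cases "0 \<le> w b")
        case True
        then show ?thesis using wb t mult_right_mono[of "1 - t" 1 "w b"] by simp
      next
        case False
        then have "(1 - t) * w b \<le> 0" using t by (intro mult_nonneg_nonpos) auto
        then show ?thesis using wb False by simp
      qed
      then have "ennreal (w' b) \<le> ennreal (t + max 0 (w b))" by (rule ennreal_leI)
      also have "\<dots> = ennreal t + ennreal (w b)"
        using t by (simp add: ennreal_plus max_def ennreal_neg)
      finally have b': "ennreal (w' b) \<le> ennreal t + ennreal (w b)" .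
      have "set_dist n S w' v \<le> sum_list (map (\<lambda>a. ennreal (w' a)) q)"
        using uS q qS by (intro set_dist_le) auto
      also have "\<dots> \<le> ennreal t + sum_list (map (\<lambda>a. ennreal (w a)) q)"
        using add_right_mono[OF b'] by (simp add: br r add.assoc)
      finally show ?thesis .
    qed
  qed
  \<comment> \<open>The bound holds path by path. Moving \<open>t\<close> to the left lets the
    infimum be taken, also over an empty set of paths, where it is infinite.\<close>
  then have "set_dist n S w' v - ennreal t \<le> set_dist n (insert x S) w v"
    unfolding set_dist_def[of n "insert x S"]
    by (intro INF_greatest) (auto simp: ennreal_minus_le_iff)
  then show ?thesis by (simp add: ennreal_minus_le_iff)
qed

lemma set_dist_head:
  assumes s: "s \<in> S" "s < n" and x: "x \<notin> S" "x < n"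
  shows "set_dist n S (w((s, x) := t)) x \<le> ennreal t"
  using set_dist_le[of s S n "[(s, x)]" x "w((s, x) := t)"] assms
  by (auto simp: apath_Kn_iff in_arcs_Kn)

text \<open>
  One step of Dijkstra's algorithm: with \<open>k = card S\<close>, the cheapest of the \<open>k * (n - k)\<close> arcs leaving
  \<open>S\<close> has expected weight \<open>1 / (k * (n - k) + 1)\<close> and is charged to all \<open>n - k\<close> remaining vertices.
\<close>

lemma nn_integral_set_dist:
  assumes "S \<subseteq> {..<n}" "S \<noteq> {}"
  shows "(\<integral>\<^sup>+w. (\<Sum>v\<in>{..<n} - S. set_dist n S w v) \<partial>(\<Pi>\<^sub>M a\<in>arcs (Kn n). uniform01))
    \<le> ennreal (\<Sum>j=card S..<n. 1 / real j)"
  using assms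
proof (induction "n - card S" arbitrary: S)
  case 0
  have "S = {..<n}"
    using 0 by (intro card_seteq) auto
  then show ?case by simp
next
  case (Suc k)
  let ?P = "\<Pi>\<^sub>M a\<in>arcs (Kn n). uniform01"
  define m where "m = card S"
  have finS: "finite S" using Suc.prems finite_subset by blast
  have m: "0 < m" "m < n" using Suc finS by (auto simp: m_def card_gt_0_iff)
  let ?A = "S \<times> ({..<n} - S)"
  have cD: "card ({..<n} - S) = n - m" using Suc.prems finS by (simp add: card_Diff_subset m_def)
  have cA: "card ?A = m * (n - m)" by (simp add: card_cartesian_product cD m_def)
  have "?A \<noteq> {}" using cA m by (metis card.empty mult_is_0 not_less0 not_less_iff_gr_or_eq zero_less_diff)
  have "(\<integral>\<^sup>+w. (\<Sum>v\<in>{..<n} - S. set_dist n S w v) \<partial>?P)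
      \<le> ennreal (n - m) * ennreal (1 / (card ?A + 1)) + ennreal (\<Sum>j=Suc m..<n. 1 / real j)"
  \<comment> \<open>The minimum over all crossing arcs is charged to the \<open>n - m\<close>
    outside vertices, and \<open>g\<close> is the same sum of distances after absorbing the head of
    the minimising arc into \<open>S\<close>.\<close>
  proof (rule nn_integral_PiM_uniform01_min_step[where g = "\<lambda>a w. \<Sum>v\<in>{..<n} - insert (snd a) S. set_dist n (insert (snd a) S) w v"])
    show "finite (arcs (Kn n))" by (rule finite_arcs_Kn)
    show "?A \<subseteq> arcs (Kn n)" using Suc.prems by (auto simp: in_arcs_Kn)
    show "?A \<noteq> {}" by fact
    show "(\<integral>\<^sup>+w. (\<Sum>v\<in>{..<n} - insert (snd a) S. set_dist n (insert (snd a) S) w v) \<partial>?P)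
      \<le> ennreal (\<Sum>j=Suc m..<n. 1 / real j)" if "a \<in> ?A" for a
    proof -
      have c: "card (insert (snd a) S) = Suc m" using that finS by (auto simp: m_def)
      then have "k = n - card (insert (snd a) S)" using Suc.hyps(2) m by (simp add: m_def)
      then show ?thesis using Suc.hyps(1)[of "insert (snd a) S"] c that Suc.prems by auto
    qed
    fix a t w assume a: "a \<in> ?A" and t: "0 \<le> (t::real)" "t \<le> 1"
    obtain s x where sx: "a = (s, x)" by (cases a)
    let ?w' = "(rescale t (?A - {a}) w)(a := t)"
    have *: "s \<in> S" "s < n" "x \<notin> S" "x < n" using a Suc.prems sx by auto
    have D: "{..<n} - S = insert x ({..<n} - insert x S)" using * by auto
    have "(\<Sum>v\<in>{..<n} - S. set_dist n S ?w' v)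
        = set_dist n S ?w' x + (\<Sum>v\<in>{..<n} - insert x S. set_dist n S ?w' v)"
      by (subst D, rule sum.insert) auto
    also have "\<dots> \<le> ennreal t + (\<Sum>v\<in>{..<n} - insert x S. ennreal t + set_dist n (insert x S) w v)"
      unfolding sx by (intro add_mono sum_mono set_dist_head set_dist_step) (use * t in auto)
    also have "\<dots> = ennreal (real (Suc (card ({..<n} - insert x S)))) * ennreal t
        + (\<Sum>v\<in>{..<n} - insert x S. set_dist n (insert x S) w v)"
      by (simp add: sum.distrib distrib_right ennreal_plus ennreal_of_nat_eq_real_of_nat add.assoc)
    also have "Suc (card ({..<n} - insert x S)) = n - m"
      using * m finS Suc.prems by (subst card_Diff_subset) (auto simp: m_def)
    finally show "(\<Sum>v\<in>{..<n} - S. set_dist n S ?w' v)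
        \<le> ennreal (n - m) * ennreal t + (\<Sum>v\<in>{..<n} - insert (snd a) S. set_dist n (insert (snd a) S) w v)"
      by (simp only: sx snd_conv)
  qed measurable
  also have "\<dots> \<le> ennreal (1 / real m) + ennreal (\<Sum>j=Suc m..<n. 1 / real j)"
  proof (rule add_right_mono)
    have "real (n - m) * (1 / (card ?A + 1)) \<le> 1 / real m"
    proof -
      have "k * (1 / (M * k + 1)) \<le> 1 / M" if "0 < M" "0 \<le> k" for k M :: real
      proof -
        have "0 < M * k + 1" using that by (simp add: add_nonneg_pos)
        then have "k * (1 / (M * k + 1)) \<le> 1 / M \<longleftrightarrow> k * M \<le> M * k + 1"
          using that by (simp add: pos_divide_le_eq pos_le_divide_eq mult.commute)
        then show ?thesis by (simp add: mult.commute)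
      qed
      from this[of "real m" "real (n - m)"] show ?thesis unfolding cA using m by (simp add: add.commute)
    qed
    then show "ennreal (n - m) * ennreal (1 / (card ?A + 1)) \<le> ennreal (1 / real m)"
      by (subst ennreal_mult[symmetric]) (auto intro: ennreal_leI)
  qed
  also have "\<dots> = ennreal (1 / real m + (\<Sum>j=Suc m..<n. 1 / real j))"
    by (rule ennreal_plus[symmetric]) (auto intro: sum_nonneg)
  also have "1 / real m + (\<Sum>j=Suc m..<n. 1 / real j) = (\<Sum>j=m..<n. 1 / real j)"
    using m by (simp add: sum.atLeast_Suc_lessThan)
  finally show ?case by (simp add: m_def)
qed

lemma nn_integral_sum_dist:
  assumes "n \<ge> 2"
  shows "(\<integral>\<^sup>+w. (\<Sum>(u, v)\<in>arcs (Kn n). set_dist n {u} w v) \<partial>(\<Pi>\<^sub>M a\<in>arcs (Kn n). uniform01))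
    \<le> ennreal (n * (1 + ln n))"
proof -
  let ?P = "\<Pi>\<^sub>M a\<in>arcs (Kn n). uniform01"
  have arcs: "arcs (Kn n) = (SIGMA u:{..<n}. {..<n} - {u})" by (auto simp: Kn_def)
  have "(\<Sum>j=1..<n. 1 / real j) = harm (n - 1)"
    unfolding harm_def using assms by (intro sum.cong) (auto simp: inverse_eq_divide)
  \<comment> \<open>\<open>harm m - ln m\<close> decreases in \<open>m\<close> and equals
    \<open>1\<close> at \<open>m = 1\<close>; the sequence is indexed with a successor, hence the
    indices \<open>0\<close> and \<open>n - 2\<close>.\<close>
  also have "\<dots> \<le> ln (n - 1) + 1" using decseqD[OF decseq_harm_diff_ln, of 0 "n - 2"] assms
    by (simp add: numeral_2_eq_2 Suc_diff_Suc harm_expand)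
  also have "\<dots> \<le> 1 + ln n" using assms by simp
  finally have h: "(\<Sum>j=1..<n. 1 / real j) \<le> 1 + ln n" .
  have "(\<integral>\<^sup>+w. (\<Sum>(u, v)\<in>arcs (Kn n). set_dist n {u} w v) \<partial>?P)
      = (\<integral>\<^sup>+w. (\<Sum>u<n. \<Sum>v\<in>{..<n} - {u}. set_dist n {u} w v) \<partial>?P)"
    by (rule nn_integral_cong, subst arcs, subst sum.Sigma) auto
  also have "\<dots> = (\<Sum>u<n. \<integral>\<^sup>+w. (\<Sum>v\<in>{..<n} - {u}. set_dist n {u} w v) \<partial>?P)"
    by (rule nn_integral_sum) measurable
  also have "\<dots> \<le> (\<Sum>u<n. ennreal (1 + ln n))"
  proof (rule sum_mono)
    fix u assume "u \<in> {..<n}"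
    then have "(\<integral>\<^sup>+w. (\<Sum>v\<in>{..<n} - {u}. set_dist n {u} w v) \<partial>?P) \<le> ennreal (\<Sum>j=card {u}..<n. 1 / real j)"
      by (intro nn_integral_set_dist) auto
    also have "\<dots> \<le> ennreal (1 + ln n)" using h by (intro ennreal_leI) simp
    finally show "(\<integral>\<^sup>+w. (\<Sum>v\<in>{..<n} - {u}. set_dist n {u} w v) \<partial>?P) \<le> ennreal (1 + ln n)" .
  qed
  also have "\<dots> = ennreal (n * (1 + ln n))"
    using assms by (simp add: ennreal_mult ennreal_of_nat_eq_real_of_nat)
  finally show ?thesis .
qed

section \<open>Exponential moments and uniqueness\<close>

abbreviation cost :: "('b \<Rightarrow> real) \<Rightarrow> 'b list \<Rightarrow> real" where
  "cost w p \<equiv> sum_list (map w p)"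

text \<open>A path repeats no arc, so its cost is a sum of independent uniform weights and the
  expectation factorises, each factor being at most \<open>1 / l\<close>.\<close>

lemma nn_integral_exp_cost:
  assumes p: "p \<in> Kn_paths n" and l: "l > 0"
  shows "(\<integral>\<^sup>+w. ennreal (exp (- (l * cost w p))) \<partial>(\<Pi>\<^sub>M a\<in>arcs (Kn n). uniform01))
    \<le> ennreal ((1 / l) ^ length p)"
proof -
  let ?P = "\<Pi>\<^sub>M a\<in>arcs (Kn n). uniform01"
  have p': "set p \<subseteq> arcs (Kn n)" "distinct p"
    using p apath_Kn_distinct by (auto simp: Kn_paths_def apath_Kn_iff)
  \<comment> \<open>Factors \<open>1\<close> off the path extend the product to all arcs, the form
    required for integrating against the product measure.\<close>
  define g where "g = (\<lambda>a x. if a \<in> set p then ennreal (exp (- (l * x))) else 1)"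
  have "ennreal (exp (- (l * cost w p))) = (\<Prod>a\<in>arcs (Kn n). g a (w a))" for w
  proof -
    have "ennreal (exp (- (l * cost w p))) = ennreal (\<Prod>a\<in>set p. exp (- (l * w a)))"
      using p'(2) by (simp add: sum_list_distinct_conv_sum_set exp_sum sum_distrib_left flip: sum_negf)
    also have "\<dots> = (\<Prod>a\<in>set p. ennreal (exp (- (l * w a))))"
      by (rule prod_ennreal[symmetric]) auto
    also have "\<dots> = (\<Prod>a\<in>arcs (Kn n). g a (w a))"
      unfolding g_def using p'(1) finite_arcs_Kn
      by (subst prod.inter_restrict[symmetric]) (auto simp: Int_absorb1)
    finally show ?thesis .
  qed
  then have "(\<integral>\<^sup>+w. ennreal (exp (- (l * cost w p))) \<partial>?P) = (\<integral>\<^sup>+w. (\<Prod>a\<in>arcs (Kn n). g a (w a)) \<partial>?P)"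
    by simp
  also have "\<dots> = (\<Prod>a\<in>arcs (Kn n). \<integral>\<^sup>+x. g a x \<partial>uniform01)"
    by (rule unif.product_nn_integral_prod) (auto simp: g_def finite_arcs_Kn)
  also have "\<dots> \<le> (\<Prod>a\<in>arcs (Kn n). if a \<in> set p then ennreal (1 / l) else 1)"
    using nn_integral_uniform01_exp_le[OF l]
    by (intro prod_mono_ennreal) (auto simp: g_def prob_space.emeasure_space_1[OF prob_space_uniform01, simplified])
  also have "\<dots> = (\<Prod>a\<in>set p. ennreal (1 / l))"
    using p'(1) finite_arcs_Kn by (subst prod.inter_restrict[symmetric]) (auto simp: Int_absorb1)
  also have "\<dots> = ennreal ((1 / l) ^ length p)"
    using p'(2) l by (simp add: distinct_card ennreal_power)
  finally show ?thesis .
qed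

lemma measurable_cost:
  assumes "set p \<subseteq> arcs (Kn n)"
  shows "(\<lambda>w. cost w p) \<in> borel_measurable (\<Pi>\<^sub>M a\<in>arcs (Kn n). uniform01)"
  using assms
proof (induction p)
  case (Cons a p)
  then have [measurable]: "a \<in> arcs (Kn n)" by auto
  have [measurable]: "(\<lambda>w. cost w p) \<in> borel_measurable (\<Pi>\<^sub>M a\<in>arcs (Kn n). uniform01)"
    using Cons by auto
  show ?case by simp
qed simp

lemma Kn_paths_arcs: "p \<in> Kn_paths n \<Longrightarrow> set p \<subseteq> arcs (Kn n)"
  by (auto simp: Kn_paths_def apath_Kn_iff)

lemma nn_integral_partition_function:
  fixes \<sigma> \<eta> :: real
  assumes n: "n > 0" and \<eta>: "\<eta> > 0"
  defines "l \<equiv> n * exp \<sigma> * (1 + \<eta>)"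
  shows "(\<integral>\<^sup>+w. ennreal (\<Sum>p\<in>Kn_paths n. exp (\<sigma> * length p - l * cost w p)) \<partial>(\<Pi>\<^sub>M a\<in>arcs (Kn n). uniform01))
    \<le> ennreal (n / \<eta>)"
proof -
  let ?P = "\<Pi>\<^sub>M a\<in>arcs (Kn n). uniform01"
  have l: "l > 0" using n \<eta> by (simp add: l_def add_pos_pos)
  \<comment> \<open>The value of \<open>l\<close> makes \<open>exp \<sigma> / l = r / n\<close>, so
    the at most \<open>n ^ (k + 1)\<close> paths of length \<open>k\<close> contribute at most
    \<open>n * r ^ k\<close>. As every path here has at least one arc, the series starts at
    \<open>k = 1\<close> and is bounded by \<open>r / (1 - r) = 1 / \<eta>\<close>.\<close>
  define r where "r = 1 / (1 + \<eta>)"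
  have r: "0 < r" "r < 1" "r / (1 - r) = 1 / \<eta>" using \<eta> by (auto simp: r_def field_simps)
  have [measurable]: "(\<lambda>w. cost w p) \<in> borel_measurable ?P" if "p \<in> Kn_paths n" for p
    by (rule measurable_cost[OF Kn_paths_arcs[OF that]])
  have "(\<integral>\<^sup>+w. ennreal (\<Sum>p\<in>Kn_paths n. exp (\<sigma> * length p - l * cost w p)) \<partial>?P)
      = (\<integral>\<^sup>+w. (\<Sum>p\<in>Kn_paths n. ennreal (exp (\<sigma> * length p)) * ennreal (exp (- (l * cost w p)))) \<partial>?P)"
    by (subst sum_ennreal[symmetric]) (auto simp: exp_diff exp_minus divide_inverse ennreal_mult)
  also have "\<dots> = (\<Sum>p\<in>Kn_paths n. ennreal (exp (\<sigma> * length p)) * (\<integral>\<^sup>+w. ennreal (exp (- (l * cost w p))) \<partial>?P))"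
    by (subst nn_integral_sum) (auto simp: nn_integral_cmult)
  also have "\<dots> \<le> (\<Sum>p\<in>Kn_paths n. ennreal (exp (\<sigma> * length p)) * ennreal ((1 / l) ^ length p))"
    by (intro sum_mono mult_left_mono nn_integral_exp_cost l) auto
  also have "\<dots> = (\<Sum>p\<in>Kn_paths n. ennreal ((r / n) ^ length p))"
  proof (rule sum.cong[OF refl])
    fix p
    have "exp (\<sigma> * length p) * (1 / l) ^ length p = (exp \<sigma> / l) ^ length p"
      by (simp add: exp_of_nat2_mult power_divide)
    also have "exp \<sigma> / l = r / n" using n by (simp add: l_def r_def)
    finally show "ennreal (exp (\<sigma> * length p)) * ennreal ((1 / l) ^ length p) = ennreal ((r / n) ^ length p)"
      using l by (simp flip: ennreal_mult)
  qed
  also have "\<dots> = ennreal (\<Sum>p\<in>Kn_paths n. (r / n) ^ length p)"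
    using r by (intro sum_ennreal) auto
  also have "(\<Sum>p\<in>Kn_paths n. (r / n) ^ length p)
      = (\<Sum>k\<in>{1..<n}. \<Sum>p\<in>{p \<in> Kn_paths n. length p = k}. (r / n) ^ length p)"
    by (rule sum.group[symmetric]) (use finite_Kn_paths length_Kn_paths in \<open>auto simp: Suc_le_eq\<close>)
  also have "\<dots> = (\<Sum>k\<in>{1..<n}. card {p \<in> Kn_paths n. length p = k} * (r / n) ^ k)"
    by simp
  also have "\<dots> \<le> (\<Sum>k\<in>{1..<n}. n * r ^ k)"
  proof (rule sum_mono)
    fix k
    have "real (card {p \<in> Kn_paths n. length p = k}) \<le> real (n ^ (k + 1))"
      using card_Kn_paths_length by (simp only: of_nat_le_iff)
    then have "card {p \<in> Kn_paths n. length p = k} * (r / n) ^ k \<le> real (n ^ (k + 1)) * (r / n) ^ k"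
      by (rule mult_right_mono) (use r in auto)
    then show "card {p \<in> Kn_paths n. length p = k} * (r / n) ^ k \<le> n * r ^ k"
      using n by (simp add: power_divide)
  qed
  also have "\<dots> = n * (\<Sum>k\<in>{1..<n}. r ^ k)" by (simp add: sum_distrib_left)
  also have "\<dots> \<le> n * (1 / \<eta>)"
  proof (rule mult_left_mono)
    have "(\<Sum>k\<in>{1..<n}. r ^ k) = r * (\<Sum>k<n - 1. r ^ k)"
      unfolding sum_distrib_left
      by (rule sum.reindex_bij_witness[of _ Suc "\<lambda>k. k - 1"]) (auto simp flip: power_Suc)
    also have "\<dots> \<le> r * (1 / (1 - r))"
      using r sum_le_suminf[of "\<lambda>k. r ^ k" "{..<n - 1}"] by (intro mult_left_mono) (auto simp: suminf_geometric)
    finally show "(\<Sum>k\<in>{1..<n}. r ^ k) \<le> 1 / \<eta>" using r by simp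
  qed simp
  finally show ?thesis by (simp add: ennreal_leI)
qed

text \<open>All paths with common ends, not only shortest ones, must have different costs. Stated
  without minimisers, this fails only if one of countably many nontrivial linear equations between
  weights holds.\<close>

definition unique_SP :: "nat \<Rightarrow> (nat \<times> nat \<Rightarrow> real) \<Rightarrow> bool" where
  "unique_SP n w \<longleftrightarrow> (\<forall>u v p q. Kn.apath n u p v \<longrightarrow> Kn.apath n u q v \<longrightarrow> cost w p = cost w q \<longrightarrow> p = q)"

text \<open>Resampling the coordinate \<open>a\<close> leaves \<open>h\<close> fixed, while the
  fresh uniform value hits any prescribed number with probability 0.\<close>

lemma AE_PiM_uniform01_neq:
  assumes I: "finite I" "a \<in> I" and h: "h \<in> borel_measurable (\<Pi>\<^sub>M i\<in>I. uniform01)"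
    and indep: "\<And>w x. h (w(a := x)) = h w"
  shows "AE w in (\<Pi>\<^sub>M i\<in>I. uniform01). w a \<noteq> h w"
proof -
  let ?P = "\<Pi>\<^sub>M i\<in>I. uniform01"
  have [measurable]: "(\<lambda>w. w a) \<in> borel_measurable ?P"
    using measurable_component_singleton[OF I(2), of "\<lambda>_. uniform01"]
    by (simp add: measurable_cong_sets[OF refl sets_uniform01])
  note h[measurable]
  let ?N = "{w \<in> space ?P. w a = h w}"
  have N: "?N \<in> sets ?P" by measurable
  have "emeasure ?P ?N = (\<integral>\<^sup>+w. indicator ?N w \<partial>?P)" using N by simp
  also have "\<dots> = (\<integral>\<^sup>+w. (\<integral>\<^sup>+x. indicator ?N (w(a := x)) \<partial>uniform01) \<partial>?P)"
    using N by (intro nn_integral_PiM_uniform01_resample[symmetric] I) auto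
  also have "\<dots> = (\<integral>\<^sup>+w. (\<integral>\<^sup>+x. 0 \<partial>uniform01) \<partial>?P)"
  proof (rule nn_integral_cong, rule nn_integral_cong_AE)
    fix w
    show "AE x in uniform01. indicator ?N (w(a := x)) = (0 :: ennreal)"
      using AE_uniform01_neq[of "h w"] by eventually_elim (auto simp: indep split: split_indicator)
  qed
  finally have "?N \<in> null_sets ?P" using N by (simp add: null_sets_def)
  then show ?thesis by (rule AE_I') auto
qed

text \<open>Some arc \<open>a\<close> of one path is missing from the other, so equal costs would
  determine \<open>w a\<close> from the remaining weights. Vertices and lists of arcs are countable,
  so the exceptional null sets can be united.\<close>

lemma AE_unique_SP: "AE w in (\<Pi>\<^sub>M a\<in>arcs (Kn n). uniform01). unique_SP n w"
proof -
  let ?P = "\<Pi>\<^sub>M a\<in>arcs (Kn n). uniform01"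
  have wlog: "AE w in ?P. cost w p \<noteq> cost w q"
    if p: "set p \<subseteq> arcs (Kn n)" "distinct p" and q: "set q \<subseteq> arcs (Kn n)" "distinct q"
      and a: "a \<in> set p" "a \<notin> set q" for p q a
  proof -
    have [measurable]: "(\<lambda>w. w b) \<in> borel_measurable ?P" if "b \<in> arcs (Kn n)" for b
      using measurable_component_singleton[OF that, of "\<lambda>_. uniform01"]
      by (simp add: measurable_cong_sets[OF refl sets_uniform01])
    have "AE w in ?P. w a \<noteq> (\<Sum>b\<in>set q. w b) - (\<Sum>b\<in>set p - {a}. w b)"
    proof (rule AE_PiM_uniform01_neq)
      show "(\<lambda>w. (\<Sum>b\<in>set q. w b) - (\<Sum>b\<in>set p - {a}. w b)) \<in> borel_measurable ?P"
        using p q by (intro borel_measurable_diff borel_measurable_sum) auto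
      show "(\<Sum>b\<in>set q. (w(a := x)) b) - (\<Sum>b\<in>set p - {a}. (w(a := x)) b)
          = (\<Sum>b\<in>set q. w b) - (\<Sum>b\<in>set p - {a}. w b)" for w x
        using a by (intro arg_cong2[where f = "(-)"] sum.cong) auto
    qed (use p a finite_arcs_Kn in auto)
    then show ?thesis
    proof eventually_elim
      case (elim w)
      have "cost w p = w a + (\<Sum>b\<in>set p - {a}. w b)"
        using p(2) a(1) by (simp add: sum_list_distinct_conv_sum_set sum.remove)
      then show ?case using elim q(2) by (simp add: sum_list_distinct_conv_sum_set)
    qed
  qed
  have "AE w in ?P. Kn.apath n u p v \<longrightarrow> Kn.apath n u q v \<longrightarrow> cost w p = cost w q \<longrightarrow> p = q" for u v p q
  proof (cases "Kn.apath n u p v \<and> Kn.apath n u q v \<and> p \<noteq> q")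
    case True
    then have *: "set p \<subseteq> arcs (Kn n)" "distinct p" "set q \<subseteq> arcs (Kn n)" "distinct q"
      using apath_Kn_distinct by (auto simp: apath_Kn_iff)
    have "\<not> set p \<subseteq> set q" using True apath_Kn_eqI by blast
    then obtain a where "a \<in> set p" "a \<notin> set q" by blast
    from wlog[OF * this] show ?thesis by eventually_elim auto
  qed auto
  then show ?thesis unfolding unique_SP_def by (simp add: AE_all_countable)
qed

section \<open>Counting shortest paths\<close>

lemma shortest_path_Kn_iff:
  "shortest_path (Kn n) w u p v \<longleftrightarrow> Kn.apath n u p v \<and> (\<forall>q. Kn.apath n u q v \<longrightarrow> cost w p \<le> cost w q)"
  by (auto simp: shortest_path_def is_arg_min_linorder awalk_cost_eq)

lemma apath_Kn_verts: "Kn.apath n u p v \<Longrightarrow> u < n \<and> v < n"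
  using Kn.awalk_last_in_verts[of n u p v] by (auto simp: Kn.apath_def)

lemma mem_SP_Kn_iff:
  "p \<in> SP (Kn n) w \<longleftrightarrow> (\<exists>u v. u \<noteq> v \<and> shortest_path (Kn n) w u p v)"
proof
  assume "p \<in> SP (Kn n) w"
  then show "\<exists>u v. u \<noteq> v \<and> shortest_path (Kn n) w u p v" unfolding SP_def by blast
next
  assume "\<exists>u v. u \<noteq> v \<and> shortest_path (Kn n) w u p v"
  then obtain u v where uv: "u \<noteq> v" "shortest_path (Kn n) w u p v" by (elim exE conjE)
  moreover from this have "u < n \<and> v < n"
    using apath_Kn_verts unfolding shortest_path_Kn_iff by (elim conjE)
  ultimately show "p \<in> SP (Kn n) w" unfolding SP_def by auto
qed

lemma SP_subset_Kn_paths: "SP (Kn n) w \<subseteq> Kn_paths n"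
proof
  fix p assume "p \<in> SP (Kn n) w"
  then obtain u v where "u \<noteq> v" "Kn.apath n u p v"
    unfolding mem_SP_Kn_iff shortest_path_Kn_iff by (elim exE conjE)
  then show "p \<in> Kn_paths n" unfolding Kn_paths_def by (intro CollectI exI conjI)
qed

lemma finite_SP_Kn [simp]: "finite (SP (Kn n) w)"
  using SP_subset_Kn_paths finite_Kn_paths by (rule finite_subset)

section \<open>A chosen shortest path for each ordered pair\<close>

text \<open>On the null event that the minimum is not unique, \<open>the_SP\<close> is an arbitrary minimiser.\<close>

definition the_SP :: "nat \<Rightarrow> (nat \<times> nat \<Rightarrow> real) \<Rightarrow> nat \<times> nat \<Rightarrow> (nat \<times> nat) list" where
  "the_SP n w = (\<lambda>(u, v). SOME p. shortest_path (Kn n) w u p v)"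

text \<open>There are finitely many paths from \<open>u\<close> to \<open>v\<close>, and the arc
  \<open>(u, v)\<close> is itself one, so a minimum exists. In the complete digraph the arcs double
  as indices for ordered pairs of distinct vertices.\<close>

lemma shortest_path_the_SP:
  assumes "(u, v) \<in> arcs (Kn n)"
  shows "shortest_path (Kn n) w u (the_SP n w (u, v)) v"
proof -
  let ?A = "{p. Kn.apath n u p v}"
  have "Kn.apath n u [(u, v)] v" using assms by (auto simp: apath_Kn_iff in_arcs_Kn)
  then have "arg_min_on (cost w) ?A \<in> ?A" "\<And>q. q \<in> ?A \<Longrightarrow> cost w (arg_min_on (cost w) ?A) \<le> cost w q"
    using arg_min_if_finite(1)[of ?A "cost w"] arg_min_least[of ?A _ "cost w"] Kn.apaths_finite by blast+
  then have "\<exists>p. shortest_path (Kn n) w u p v" unfolding shortest_path_Kn_iff by blast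
  then show ?thesis unfolding the_SP_def prod.case by (rule someI_ex)
qed

lemma unique_SPD:
  "unique_SP n w \<Longrightarrow> Kn.apath n u p v \<Longrightarrow> Kn.apath n u q v \<Longrightarrow> cost w p = cost w q \<Longrightarrow> p = q"
  by (simp add: unique_SP_def)

lemma shortest_path_unique:
  assumes "unique_SP n w" "shortest_path (Kn n) w u p v" "shortest_path (Kn n) w u q v"
  shows "p = q"
  using assms by (intro unique_SPD[OF assms(1), of u p v q] order_antisym) (simp_all add: shortest_path_Kn_iff)

text \<open>Nonempty paths carry their ends with them. Chosen paths of different pairs therefore
  differ even under different weights, so sets of paths can be counted by their pairs.\<close>

lemma the_SP_ends:
  assumes "a \<in> arcs (Kn n)"
  shows "(fst (hd (the_SP n w a)), snd (last (the_SP n w a))) = a"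
proof -
  have "Kn.apath n (fst a) (the_SP n w a) (snd a)" "fst a \<noteq> snd a"
    using shortest_path_the_SP[of "fst a" "snd a" n w] assms by (auto simp: shortest_path_Kn_iff in_arcs_Kn)
  then show ?thesis
    using cas_Kn_ends apath_Kn_nonempty by (metis apath_Kn_iff prod.collapse)
qed

lemma the_SP_eq_imp:
  "a \<in> arcs (Kn n) \<Longrightarrow> b \<in> arcs (Kn n) \<Longrightarrow> the_SP n w a = the_SP n w' b \<Longrightarrow> a = b"
  by (metis the_SP_ends)

lemma inj_on_the_SP: "inj_on (the_SP n w) (arcs (Kn n))"
  by (rule inj_onI) (rule the_SP_eq_imp)

lemma SP_eq_image:
  assumes "unique_SP n w"
  shows "SP (Kn n) w = the_SP n w ` arcs (Kn n)"
proof (intro set_eqI iffI)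
  fix p assume "p \<in> SP (Kn n) w"
  then obtain u v where uv: "u \<noteq> v" "shortest_path (Kn n) w u p v" by (auto simp: mem_SP_Kn_iff)
  then have arc: "(u, v) \<in> arcs (Kn n)"
    using apath_Kn_verts by (auto simp: shortest_path_Kn_iff in_arcs_Kn)
  then have "p = the_SP n w (u, v)"
    using shortest_path_unique[OF assms uv(2)] shortest_path_the_SP by blast
  then show "p \<in> the_SP n w ` arcs (Kn n)" using arc by blast
next
  fix p assume "p \<in> the_SP n w ` arcs (Kn n)"
  then obtain u v where "(u, v) \<in> arcs (Kn n)" "p = the_SP n w (u, v)" by auto
  moreover from this have "shortest_path (Kn n) w u p v" "u \<noteq> v"
    using shortest_path_the_SP by (auto simp: in_arcs_Kn)
  ultimately show "p \<in> SP (Kn n) w"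
    unfolding mem_SP_Kn_iff by blast
qed

lemma card_SP: "unique_SP n w \<Longrightarrow> card (SP (Kn n) w) = n * (n - 1)"
  by (simp add: SP_eq_image card_image inj_on_the_SP card_arcs_Kn)

lemma card_SP_through:
  "unique_SP n w \<Longrightarrow> card (SP_through (Kn n) w e) = card {a \<in> arcs (Kn n). e \<in> set (the_SP n w a)}"
proof -
  assume "unique_SP n w"
  then have "SP_through (Kn n) w e = the_SP n w ` {a \<in> arcs (Kn n). e \<in> set (the_SP n w a)}"
    by (auto simp: SP_through_def SP_eq_image)
  then show ?thesis
    by (simp add: card_image inj_on_subset[OF inj_on_the_SP])
qed

text \<open>A shortest path for \<open>w\<close> can reappear among those for \<open>w'\<close> only
  at its own pair, so being lost means being replaced at that pair.\<close>

lemma card_SP_changed: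
  assumes "unique_SP n w" "unique_SP n w'"
  shows "card (SP_through (Kn n) w e \<union> (SP (Kn n) w - SP (Kn n) w'))
    = card {a \<in> arcs (Kn n). e \<in> set (the_SP n w a) \<or> the_SP n w a \<noteq> the_SP n w' a}"
proof -
  have *: "the_SP n w a \<in> the_SP n w' ` arcs (Kn n) \<longleftrightarrow> the_SP n w a = the_SP n w' a"
    if a: "a \<in> arcs (Kn n)" for a
  proof
    assume "the_SP n w a \<in> the_SP n w' ` arcs (Kn n)"
    then obtain b where b: "the_SP n w a = the_SP n w' b" "b \<in> arcs (Kn n)" by (rule imageE)
    then show "the_SP n w a = the_SP n w' a" using the_SP_eq_imp[OF a b(2,1)] by simp
  qed (use a in simp)
  have "SP_through (Kn n) w e \<union> (SP (Kn n) w - SP (Kn n) w')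
      = the_SP n w ` {a \<in> arcs (Kn n). e \<in> set (the_SP n w a) \<or> the_SP n w a \<noteq> the_SP n w' a}"
    unfolding SP_through_def SP_eq_image[OF assms(1)] SP_eq_image[OF assms(2)]
    using * by auto
  then show ?thesis
    by (simp add: card_image inj_on_subset[OF inj_on_the_SP])
qed

text \<open>If the two chosen paths of a pair differ, both counts include the pair; if they agree,
  \<open>e\<close> lies on both or on neither.\<close>

lemma card_SP_minus_eq_plus:
  assumes "unique_SP n w" "unique_SP n w'"
  shows "card (SP_minus (Kn n) w w' e) = card (SP_plus (Kn n) w w' e)"
  unfolding SP_minus_def SP_plus_def card_SP_changed[OF assms] card_SP_changed[OF assms(2,1)]
  by (rule arg_cong[where f = card]) auto

lemma cost_fun_upd: "e \<notin> set p \<Longrightarrow> cost (w(e := x)) p = cost w p"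
  by (induction p) auto

text \<open>Neither chosen path uses \<open>e\<close>, so the update changes neither cost. The two
  minimality inequalities then give equal costs under \<open>w\<close>, and uniqueness identifies
  the paths.\<close>

lemma the_SP_update:
  assumes "unique_SP n w" "a \<in> arcs (Kn n)" "e \<notin> set (the_SP n w a)" "e \<notin> set (the_SP n (w(e := x)) a)"
  shows "the_SP n (w(e := x)) a = the_SP n w a"
proof -
  obtain u v where uv: "a = (u, v)" by (cases a)
  define w' where "w' = w(e := x)"
  have S: "shortest_path (Kn n) w u (the_SP n w a) v" "shortest_path (Kn n) w' u (the_SP n w' a) v"
    unfolding uv by (rule shortest_path_the_SP, use assms uv in simp)+
  have "cost w (the_SP n w a) \<le> cost w (the_SP n w' a)" "cost w' (the_SP n w' a) \<le> cost w' (the_SP n w a)"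
    using S unfolding shortest_path_Kn_iff by blast+
  moreover have "cost w' (the_SP n w a) = cost w (the_SP n w a)" "cost w' (the_SP n w' a) = cost w (the_SP n w' a)"
    unfolding w'_def by (rule cost_fun_upd, fact)+
  ultimately have "cost w (the_SP n w' a) = cost w (the_SP n w a)" by linarith
  then show ?thesis
    using S unique_SPD[OF assms(1)] unfolding shortest_path_Kn_iff w'_def[symmetric] by blast
qed

lemma card_SP_plus_le:
  assumes "unique_SP n w" "unique_SP n (w(e := x))"
  shows "card (SP_plus (Kn n) w (w(e := x)) e)
    \<le> card (SP_through (Kn n) w e) + card (SP_through (Kn n) (w(e := x)) e)"
proof -
  let ?w = "w(e := x)"
  have "{a \<in> arcs (Kn n). e \<in> set (the_SP n ?w a) \<or> the_SP n ?w a \<noteq> the_SP n w a}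
      \<subseteq> {a \<in> arcs (Kn n). e \<in> set (the_SP n w a)} \<union> {a \<in> arcs (Kn n). e \<in> set (the_SP n ?w a)}"
    using the_SP_update[OF assms(1)] by blast
  then have "card {a \<in> arcs (Kn n). e \<in> set (the_SP n ?w a) \<or> the_SP n ?w a \<noteq> the_SP n w a}
      \<le> card ({a \<in> arcs (Kn n). e \<in> set (the_SP n w a)} \<union> {a \<in> arcs (Kn n). e \<in> set (the_SP n ?w a)})"
    by (intro card_mono) (auto simp: finite_arcs_Kn)
  also have "\<dots> \<le> card {a \<in> arcs (Kn n). e \<in> set (the_SP n w a)} + card {a \<in> arcs (Kn n). e \<in> set (the_SP n ?w a)}"
    by (rule card_Un_le)
  finally show ?thesis
    unfolding SP_plus_def card_SP_changed[OF assms(2,1)] card_SP_through[OF assms(1)] card_SP_through[OF assms(2)] .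
qed

text \<open>Double counting of incidences between arcs and shortest paths: it turns the choice of a
  uniform arc into the average number of arcs of a shortest path.\<close>

lemma sum_card_SP_through:
  "(\<Sum>e\<in>arcs (Kn n). card (SP_through (Kn n) w e)) = (\<Sum>p\<in>SP (Kn n) w. length p)"
proof -
  have "(\<Sum>e\<in>arcs (Kn n). card (SP_through (Kn n) w e))
      = (\<Sum>e\<in>arcs (Kn n). \<Sum>p\<in>SP (Kn n) w. if e \<in> set p then 1 else 0)"
    by (intro sum.cong refl, subst sum.inter_filter[symmetric]) (auto simp: SP_through_def)
  also have "\<dots> = (\<Sum>p\<in>SP (Kn n) w. \<Sum>e\<in>arcs (Kn n). if e \<in> set p then 1 else 0)"
    by (rule sum.swap)
  also have "\<dots> = (\<Sum>p\<in>SP (Kn n) w. length p)"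
  proof (rule sum.cong[OF refl])
    fix p assume "p \<in> SP (Kn n) w"
    then have p: "p \<in> Kn_paths n" using SP_subset_Kn_paths by blast
    then have "distinct p" using apath_Kn_distinct by (auto simp: Kn_paths_def)
    moreover have "{e \<in> arcs (Kn n). e \<in> set p} = set p" using Kn_paths_arcs[OF p] by auto
    ultimately show "(\<Sum>e\<in>arcs (Kn n). if e \<in> set p then 1 else 0) = length p"
      by (subst sum.inter_filter[symmetric]) (auto simp: finite_arcs_Kn distinct_card)
  qed
  finally show ?thesis .
qed

text \<open>Truncating negative weights at \<open>0\<close> can only increase the sum.\<close>

lemma ennreal_sum_list_le: "ennreal (cost w p) \<le> sum_list (map (\<lambda>a. ennreal (w a)) p)"
proof (induction p)
  case (Cons a p)
  have "ennreal (w a + cost w p) \<le> ennreal (max 0 (w a) + max 0 (cost w p))"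
    by (rule ennreal_leI) simp
  also have "\<dots> = ennreal (w a) + ennreal (cost w p)"
    by (simp add: ennreal_plus max_def ennreal_neg)
  finally show ?case using Cons by (simp add: add_left_mono order_trans)
qed simp

lemma cost_the_SP_le:
  assumes "(u, v) \<in> arcs (Kn n)"
  shows "ennreal (cost w (the_SP n w (u, v))) \<le> set_dist n {u} w v"
  unfolding set_dist_def
proof (rule INF_greatest)
  fix p assume "p \<in> {p. \<exists>x\<in>{u}. Kn.apath n x p v \<and> snd ` set p \<inter> {u} = {}}"
  then have "cost w (the_SP n w (u, v)) \<le> cost w p"
    using shortest_path_the_SP[OF assms] by (auto simp: shortest_path_Kn_iff)
  then show "ennreal (cost w (the_SP n w (u, v))) \<le> sum_list (map (\<lambda>a. ennreal (w a)) p)"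
    using ennreal_sum_list_le[of w p] by (meson ennreal_leI order_trans)
qed

text \<open>The logarithm is replaced by its tangent: \<open>y \<le> ln z - 1 + exp y / z\<close>
  for every \<open>z > 0\<close>, applied to each shortest path with
  \<open>y = \<sigma> * length p - l * cost w p\<close>. The result is linear in the exponential
  sum, so it can be integrated directly, and \<open>z\<close> is chosen afterwards.\<close>

lemma sum_length_SP_le:
  fixes \<sigma> l z :: real
  assumes uniq: "unique_SP n w" and w: "\<And>a. a \<in> arcs (Kn n) \<Longrightarrow> 0 \<le> w a"
    and l: "0 < l" and z: "0 < z"
  shows "ennreal (\<sigma> * (\<Sum>p\<in>SP (Kn n) w. length p) + real (n * (n - 1)) * (1 - ln z))
    \<le> ennreal l * (\<Sum>(u, v)\<in>arcs (Kn n). set_dist n {u} w v)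
      + ennreal (1 / z) * ennreal (\<Sum>p\<in>Kn_paths n. exp (\<sigma> * length p - l * cost w p))"
proof -
  let ?Z = "\<Sum>p\<in>Kn_paths n. exp (\<sigma> * length p - l * cost w p)"
  have c0: "0 \<le> cost w p" if "p \<in> SP (Kn n) w" for p
  proof -
    have "set p \<subseteq> arcs (Kn n)" using Kn_paths_arcs[OF subsetD[OF SP_subset_Kn_paths that]] .
    then show ?thesis by (intro sum_list_nonneg) (auto intro: w)
  qed
  have "\<sigma> * length p + (1 - ln z) \<le> l * cost w p + exp (\<sigma> * length p - l * cost w p) / z" for p
  proof -
    let ?y = "\<sigma> * length p - l * cost w p"
    have "1 + (?y - ln z) \<le> exp (?y - ln z)" by (rule exp_ge_add_one_self)
    also have "\<dots> = exp ?y / z" using z by (simp add: exp_diff)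
    finally show ?thesis by simp
  qed
  then have "(\<Sum>p\<in>SP (Kn n) w. \<sigma> * length p + (1 - ln z))
      \<le> (\<Sum>p\<in>SP (Kn n) w. l * cost w p + exp (\<sigma> * length p - l * cost w p) / z)"
    by (rule sum_mono)
  also have "\<dots> = l * (\<Sum>p\<in>SP (Kn n) w. cost w p) + (\<Sum>p\<in>SP (Kn n) w. exp (\<sigma> * length p - l * cost w p)) / z"
    by (simp add: sum.distrib sum_distrib_left sum_divide_distrib)
  \<comment> \<open>Adding the positive terms of all other paths replaces the sum over the random
    set \<open>SP\<close> by one over a fixed set.\<close>
  also have "\<dots> \<le> l * (\<Sum>p\<in>SP (Kn n) w. cost w p) + ?Z / z"
    using z by (intro add_left_mono divide_right_mono sum_mono2 finite_Kn_paths SP_subset_Kn_paths) auto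
  finally have "\<sigma> * (\<Sum>p\<in>SP (Kn n) w. length p) + real (n * (n - 1)) * (1 - ln z)
      \<le> l * (\<Sum>p\<in>SP (Kn n) w. cost w p) + 1 / z * ?Z"
    by (simp add: sum.distrib sum_distrib_left sum_divide_distrib card_SP[OF uniq])
  then have "ennreal (\<sigma> * (\<Sum>p\<in>SP (Kn n) w. length p) + real (n * (n - 1)) * (1 - ln z))
      \<le> ennreal (l * (\<Sum>p\<in>SP (Kn n) w. cost w p) + 1 / z * ?Z)"
    by (rule ennreal_leI)
  also have "\<dots> = ennreal l * ennreal (\<Sum>p\<in>SP (Kn n) w. cost w p) + ennreal (1 / z) * ennreal ?Z"
    using l z c0 by (subst ennreal_plus) (auto simp: sum_nonneg intro!: mult_nonneg_nonneg simp flip: ennreal_mult)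
  also have "ennreal (\<Sum>p\<in>SP (Kn n) w. cost w p) = (\<Sum>p\<in>SP (Kn n) w. ennreal (cost w p))"
    using c0 by (simp add: sum_ennreal)
  also have "\<dots> = (\<Sum>a\<in>arcs (Kn n). ennreal (cost w (the_SP n w a)))"
    unfolding SP_eq_image[OF uniq] by (simp add: sum.reindex[OF inj_on_the_SP])
  also have "\<dots> \<le> (\<Sum>(u, v)\<in>arcs (Kn n). set_dist n {u} w v)"
    by (intro sum_mono) (auto intro: cost_the_SP_le)
  finally show ?thesis by (simp add: add_right_mono mult_left_mono)
qed

section \<open>The edge update\<close>

abbreviation weights :: "nat \<Rightarrow> (nat \<times> nat \<Rightarrow> real) measure" where
  "weights n \<equiv> \<Pi>\<^sub>M a\<in>arcs (Kn n). uniform01"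

abbreviation update :: "(nat \<times> nat \<Rightarrow> real) \<times> (nat \<times> nat) \<times> real \<Rightarrow> nat \<times> nat \<Rightarrow> real" where
  "update z \<equiv> (fst z)(fst (snd z) := snd (snd z))"

lemma sigma_finite_uniform01: "sigma_finite_measure uniform01"
  by (rule prob_space_imp_sigma_finite) (rule prob_space_uniform01)

lemma prob_space_weights: "prob_space (weights n)"
  by (intro prob_space_PiM prob_space_uniform01)

lemma nn_integral_edge_update:
  assumes n: "n \<ge> 2" and f: "f \<in> borel_measurable (edge_update n)"
  shows "(\<integral>\<^sup>+z. f z \<partial>edge_update n)
    = ennreal (1 / real (n * (n - 1))) * (\<Sum>e\<in>arcs (Kn n). \<integral>\<^sup>+w. (\<integral>\<^sup>+x. f (w, e, x) \<partial>uniform01) \<partial>weights n)"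
proof -
  let ?C = "uniform_count_measure (arcs (Kn n))"
  have "(0, 1) \<in> arcs (Kn n)" using n by (simp add: in_arcs_Kn)
  then have C: "prob_space ?C"
    using finite_arcs_Kn by (intro prob_space_uniform_count_measure) auto
  interpret CU: pair_prob_space ?C uniform01
    by (intro pair_prob_space.intro pair_sigma_finite.intro prob_space_imp_sigma_finite C prob_space_uniform01)
  have CU: "sigma_finite_measure (?C \<Otimes>\<^sub>M uniform01)"
    by (rule prob_space_imp_sigma_finite) (rule CU.prob_space_axioms)
  note f[unfolded edge_update_def, measurable]
  have m: "(\<lambda>w. \<integral>\<^sup>+x. f (w, e, x) \<partial>uniform01) \<in> borel_measurable (weights n)" if "e \<in> arcs (Kn n)" for e
  proof (rule sigma_finite_measure.borel_measurable_nn_integral[OF sigma_finite_uniform01])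
    have [measurable]: "(\<lambda>x. e) \<in> weights n \<Otimes>\<^sub>M uniform01 \<rightarrow>\<^sub>M ?C"
      using that by (intro measurable_const) (simp add: space_uniform_count_measure)
    show "(\<lambda>(w, x). f (w, e, x)) \<in> borel_measurable (weights n \<Otimes>\<^sub>M uniform01)"
      by measurable
  qed
  have "(\<integral>\<^sup>+z. f z \<partial>edge_update n) = (\<integral>\<^sup>+w. (\<integral>\<^sup>+y. f (w, y) \<partial>(?C \<Otimes>\<^sub>M uniform01)) \<partial>weights n)"
    unfolding edge_update_def by (rule sigma_finite_measure.nn_integral_fst[OF CU, symmetric]) measurable
  also have "\<dots> = (\<integral>\<^sup>+w. (\<Sum>e\<in>arcs (Kn n). ennreal (1 / real (n * (n - 1))) * (\<integral>\<^sup>+x. f (w, e, x) \<partial>uniform01)) \<partial>weights n)"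
  proof (rule nn_integral_cong)
    fix w assume w: "w \<in> space (weights n)"
    have "(\<lambda>y. f (w, y)) \<in> borel_measurable (?C \<Otimes>\<^sub>M uniform01)"
      using w by measurable
    then have "(\<integral>\<^sup>+y. f (w, y) \<partial>(?C \<Otimes>\<^sub>M uniform01)) = (\<integral>\<^sup>+e. (\<integral>\<^sup>+x. f (w, e, x) \<partial>uniform01) \<partial>?C)"
      by (rule sigma_finite_measure.nn_integral_fst[OF sigma_finite_uniform01, symmetric])
    also have "\<dots> = (\<Sum>e\<in>arcs (Kn n). ennreal (1 / real (n * (n - 1))) * (\<integral>\<^sup>+x. f (w, e, x) \<partial>uniform01))"
      unfolding uniform_count_measure_def
      by (subst nn_integral_point_measure_finite[OF finite_arcs_Kn]) (simp add: card_arcs_Kn)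
    finally show "(\<integral>\<^sup>+y. f (w, y) \<partial>(?C \<Otimes>\<^sub>M uniform01)) = \<dots>" .
  qed
  also have "\<dots> = (\<Sum>e\<in>arcs (Kn n). \<integral>\<^sup>+w. ennreal (1 / real (n * (n - 1))) * (\<integral>\<^sup>+x. f (w, e, x) \<partial>uniform01) \<partial>weights n)"
    using m by (intro nn_integral_sum borel_measurable_times_ennreal) auto
  also have "\<dots> = (\<Sum>e\<in>arcs (Kn n). ennreal (1 / real (n * (n - 1))) * (\<integral>\<^sup>+w. (\<integral>\<^sup>+x. f (w, e, x) \<partial>uniform01) \<partial>weights n))"
    using m by (intro sum.cong refl nn_integral_cmult)
  finally show ?thesis by (simp add: sum_distrib_left)
qed

section \<open>Measurability and laws of the old and new weights\<close>

lemma measurable_edge_update_edge: "(\<lambda>z. fst (snd z)) \<in> edge_update n \<rightarrow>\<^sub>M count_space (arcs (Kn n))"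
proof -
  have "(\<lambda>z. fst (snd z)) \<in> edge_update n \<rightarrow>\<^sub>M uniform_count_measure (arcs (Kn n))"
    unfolding edge_update_def by measurable
  then show ?thesis
    by (simp add: measurable_cong_sets[OF refl sets_uniform_count_measure_count_space])
qed

lemma measurable_edge_update_old: "fst \<in> edge_update n \<rightarrow>\<^sub>M weights n"
  unfolding edge_update_def by measurable

lemma measurable_edge_update_new: "update \<in> edge_update n \<rightarrow>\<^sub>M weights n"
proof (rule measurable_PiM_single')
  fix a assume a: "a \<in> arcs (Kn n)"
  have [measurable]: "(\<lambda>z. snd (snd z)) \<in> edge_update n \<rightarrow>\<^sub>M uniform01"
    unfolding edge_update_def by measurable
  have [measurable]: "(\<lambda>z. fst z a) \<in> edge_update n \<rightarrow>\<^sub>M uniform01"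
    using measurable_compose[OF measurable_edge_update_old measurable_component_singleton[OF a]] .
  have [measurable]: "Measurable.pred (edge_update n) (\<lambda>z. a = fst (snd z))"
    by (rule measurable_compose[OF measurable_edge_update_edge]) simp
  have "(\<lambda>z. if a = fst (snd z) then snd (snd z) else fst z a) \<in> edge_update n \<rightarrow>\<^sub>M uniform01"
    by measurable
  then show "(\<lambda>z. update z a) \<in> edge_update n \<rightarrow>\<^sub>M uniform01"
    by (simp add: fun_upd_def)
next
  show "update \<in> space (edge_update n) \<rightarrow> (\<Pi>\<^sub>E a\<in>arcs (Kn n). space uniform01)"
    by (auto simp: edge_update_def space_pair_measure space_PiM space_uniform_count_measure PiE_iff extensional_def)
qed

lemma nn_integral_edge_update_old:
  assumes n: "n \<ge> 2" and m: "(\<lambda>z. f (fst (snd z)) (fst z)) \<in> borel_measurable (edge_update n)"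
  shows "(\<integral>\<^sup>+z. f (fst (snd z)) (fst z) \<partial>edge_update n)
    = ennreal (1 / real (n * (n - 1))) * (\<Sum>e\<in>arcs (Kn n). \<integral>\<^sup>+w. f e w \<partial>weights n)"
  by (subst nn_integral_edge_update[OF n m])
    (simp add: prob_space.emeasure_space_1[OF prob_space_uniform01, simplified])

text \<open>For each fixed arc \<open>e\<close>, overwriting its weight by an independent uniform
  one preserves the law, so the new weights integrate exactly like the old ones.\<close>

lemma nn_integral_edge_update_new:
  assumes n: "n \<ge> 2" and f: "\<And>e. e \<in> arcs (Kn n) \<Longrightarrow> f e \<in> borel_measurable (weights n)"
    and m: "(\<lambda>z. f (fst (snd z)) (update z)) \<in> borel_measurable (edge_update n)"
  shows "(\<integral>\<^sup>+z. f (fst (snd z)) (update z) \<partial>edge_update n)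
    = ennreal (1 / real (n * (n - 1))) * (\<Sum>e\<in>arcs (Kn n). \<integral>\<^sup>+w. f e w \<partial>weights n)"
  unfolding nn_integral_edge_update[OF n m]
  by (intro arg_cong2[where f = "(*)"] refl sum.cong)
    (simp add: nn_integral_PiM_uniform01_resample[OF finite_arcs_Kn _ f] del: fun_upd_apply)

text \<open>As \<open>Q\<close> may be non-measurable, its failure set is enclosed in a measurable
  null set \<open>N\<close>. The preimages of \<open>N\<close> under the old and the new weights are
  null because both have the law \<open>weights n\<close>.\<close>

lemma AE_edge_update:
  assumes n: "n \<ge> 2" and Q: "AE w in weights n. Q w"
  shows "AE z in edge_update n. Q (fst z) \<and> Q (update z)"
proof -
  obtain N where N: "{w \<in> space (weights n). \<not> Q w} \<subseteq> N" "N \<in> sets (weights n)" "emeasure (weights n) N = 0"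
    using Q by (rule AE_E)
  note N(2)[measurable] measurable_edge_update_old[measurable] measurable_edge_update_new[measurable]
  have "(\<integral>\<^sup>+z. indicator N (fst z) \<partial>edge_update n) = (0 :: ennreal)"
    using nn_integral_edge_update_old[OF n, of "\<lambda>_. indicator N"] N by simp
  then have old: "AE z in edge_update n. indicator N (fst z) = (0 :: ennreal)"
    by (subst (asm) nn_integral_0_iff_AE) auto
  have "(\<lambda>z. indicator N (update z) :: ennreal) \<in> borel_measurable (edge_update n)"
    by (rule measurable_compose[OF measurable_edge_update_new]) simp
  moreover from this have "(\<integral>\<^sup>+z. indicator N (update z) \<partial>edge_update n) = (0 :: ennreal)"
    using nn_integral_edge_update_new[OF n, of "\<lambda>_. indicator N"] N by (simp del: fun_upd_apply)
  ultimately have new: "AE z in edge_update n. indicator N (update z) = (0 :: ennreal)"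
    by (subst (asm) nn_integral_0_iff_AE)
  show ?thesis
    using old new AE_space
  proof eventually_elim
    case (elim z)
    then have "fst z \<in> space (weights n)" "update z \<in> space (weights n)"
      using measurable_space[OF measurable_edge_update_old] measurable_space[OF measurable_edge_update_new] by blast+
    moreover have "fst z \<notin> N" "update z \<notin> N"
      using elim by (auto simp: indicator_eq_0_iff simp del: fun_upd_apply)
    ultimately show ?case using N(1) by blast
  qed
qed

text \<open>The ends of \<open>p\<close> are determined by \<open>p\<close>, so membership amounts
  to comparing its cost with those of the finitely many paths between these ends.\<close>

lemma pred_SP: "Measurable.pred (weights n) (\<lambda>w. p \<in> SP (Kn n) w)"
proof (cases "p \<in> Kn_paths n")
  case False
  then have "p \<notin> SP (Kn n) w" for w using SP_subset_Kn_paths by blast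
  then show ?thesis by simp
next
  case True
  then obtain u v where uv: "u \<noteq> v" "Kn.apath n u p v" by (auto simp: Kn_paths_def)
  have u': "u' = u \<and> v' = v" if "Kn.apath n u' p v'" for u' v'
    using that uv cas_Kn_ends[of n u' p v'] cas_Kn_ends[of n u p v] apath_Kn_nonempty[OF uv(2,1)]
    by (simp add: apath_Kn_iff)
  have "p \<in> SP (Kn n) w \<longleftrightarrow> (\<forall>q\<in>{q. Kn.apath n u q v}. cost w p \<le> cost w q)" for w
  proof
    assume "p \<in> SP (Kn n) w"
    then obtain u' v' where "shortest_path (Kn n) w u' p v'" unfolding mem_SP_Kn_iff by (elim exE conjE)
    moreover from this have "u' = u" "v' = v" using u' unfolding shortest_path_Kn_iff by blast+
    ultimately show "\<forall>q\<in>{q. Kn.apath n u q v}. cost w p \<le> cost w q"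
      unfolding shortest_path_Kn_iff by simp
  next
    assume "\<forall>q\<in>{q. Kn.apath n u q v}. cost w p \<le> cost w q"
    then have "shortest_path (Kn n) w u p v" using uv by (simp add: shortest_path_Kn_iff)
    then show "p \<in> SP (Kn n) w" unfolding mem_SP_Kn_iff using uv(1) by (intro exI conjI)
  qed
  moreover have "Measurable.pred (weights n) (\<lambda>w. \<forall>q\<in>{q. Kn.apath n u q v}. cost w p \<le> cost w q)"
  proof (rule pred_intros_finite(3))
    show "finite {q. Kn.apath n u q v}" by (rule Kn.apaths_finite)
    fix q assume "q \<in> {q. Kn.apath n u q v}"
    then have "(\<lambda>w. cost w p) \<in> borel_measurable (weights n)" "(\<lambda>w. cost w q) \<in> borel_measurable (weights n)"
      using uv by (auto intro!: measurable_cost simp: apath_Kn_iff)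
    show "Measurable.pred (weights n) (\<lambda>w. cost w p \<le> cost w q)"
      unfolding pred_def by (rule borel_measurable_le) fact+
  qed
  ultimately show ?thesis by simp
qed

lemma pred_edge_update:
  "Measurable.pred (edge_update n) (\<lambda>z. p \<in> SP (Kn n) (fst z))"
  "Measurable.pred (edge_update n) (\<lambda>z. p \<in> SP (Kn n) (update z))"
  "Measurable.pred (edge_update n) (\<lambda>z. fst (snd z) \<in> set p)"
  by (rule measurable_compose[OF measurable_edge_update_old pred_SP]
      measurable_compose[OF measurable_edge_update_new pred_SP]
      measurable_compose[OF measurable_edge_update_edge] | simp)+

lemma measurable_card_Kn_paths:
  assumes "\<And>p. Measurable.pred M (\<lambda>z. p \<in> A z)" "\<And>z. A z \<subseteq> Kn_paths n"
  shows "(\<lambda>z. real (card (A z))) \<in> borel_measurable M"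
proof -
  have "real (card (A z)) = (\<Sum>p\<in>Kn_paths n. if p \<in> A z then 1 else 0)" for z
    using assms(2)[of z] by (subst sum.inter_filter[symmetric])
      (auto simp: finite_Kn_paths intro!: arg_cong[where f = card])
  then show ?thesis using assms(1) by simp
qed

lemma SP_plus_subset: "SP_plus (Kn n) w w' e \<subseteq> Kn_paths n" "SP_minus (Kn n) w w' e \<subseteq> Kn_paths n"
  "SP_through (Kn n) w e \<subseteq> Kn_paths n"
  using SP_subset_Kn_paths unfolding SP_plus_def SP_minus_def SP_through_def by blast+

lemma card_SP_plus_eq: "card_SP_plus n = (\<lambda>z. real (card (SP_plus (Kn n) (fst z) (update z) (fst (snd z)))))"
  "card_SP_minus n = (\<lambda>z. real (card (SP_minus (Kn n) (fst z) (update z) (fst (snd z)))))"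
  by (auto simp: card_SP_plus_def card_SP_minus_def)

lemma measurable_card_SP:
  "card_SP_plus n \<in> borel_measurable (edge_update n)"
  "card_SP_minus n \<in> borel_measurable (edge_update n)"
  unfolding card_SP_plus_eq
proof (rule_tac [!] measurable_card_Kn_paths[where n = n])
  note pred_edge_update[measurable]
  show "Measurable.pred (edge_update n) (\<lambda>z. p \<in> SP_plus (Kn n) (fst z) (update z) (fst (snd z)))" for p
    unfolding SP_plus_def SP_through_def Un_iff Diff_iff mem_Collect_eq by measurable
  show "Measurable.pred (edge_update n) (\<lambda>z. p \<in> SP_minus (Kn n) (fst z) (update z) (fst (snd z)))" for p
    unfolding SP_minus_def SP_through_def Un_iff Diff_iff mem_Collect_eq by measurable
qed (rule SP_plus_subset)+

lemma integrable_card_SP: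
  assumes n: "n \<ge> 2"
  shows "integrable (edge_update n) (card_SP_plus n)" "integrable (edge_update n) (card_SP_minus n)"
proof -
  interpret prob_space "edge_update n" by (rule prob_space_edge_update[OF n])
  have "norm (card_SP_plus n z) \<le> card (Kn_paths n)" "norm (card_SP_minus n z) \<le> card (Kn_paths n)" for z
    by (simp_all add: card_SP_plus_eq card_mono[OF finite_Kn_paths] SP_plus_subset del: fun_upd_apply)
  then show "integrable (edge_update n) (card_SP_plus n)" "integrable (edge_update n) (card_SP_minus n)"
    by (auto intro!: integrable_const_bound[where B = "card (Kn_paths n)"] measurable_card_SP)
qed

section \<open>Expected sizes of the two sets\<close>

lemma integral_card_SP_minus_eq_plus:
  assumes n: "n \<ge> 2"
  shows "integral\<^sup>L (edge_update n) (card_SP_minus n) = integral\<^sup>L (edge_update n) (card_SP_plus n)"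
proof (rule integral_cong_AE)
  show "AE z in edge_update n. card_SP_minus n z = card_SP_plus n z"
    using AE_edge_update[OF n AE_unique_SP]
    by eventually_elim (simp add: card_SP_plus_eq card_SP_minus_eq_plus del: fun_upd_apply)
qed (rule measurable_card_SP)+

text \<open>
  The old and the new weights have the same law, so both terms of the bound \<open>card_SP_plus_le\<close> contribute
  the average number of arcs of a shortest path.
\<close>

lemma nn_integral_card_SP_plus_le:
  assumes n: "n \<ge> 2"
  shows "(\<integral>\<^sup>+z. ennreal (card_SP_plus n z) \<partial>edge_update n)
    \<le> ennreal (2 / real (n * (n - 1))) * (\<integral>\<^sup>+w. ennreal (\<Sum>p\<in>SP (Kn n) w. length p) \<partial>weights n)"
proof -
  note pred_edge_update[measurable] pred_SP[measurable]
  define f where "f = (\<lambda>e w. ennreal (card (SP_through (Kn n) w e)))"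
  have pt: "Measurable.pred (weights n) (\<lambda>w. p \<in> SP_through (Kn n) w e)" for p e
    unfolding SP_through_def mem_Collect_eq by measurable
  have f: "f e \<in> borel_measurable (weights n)" for e
    unfolding f_def using measurable_card_Kn_paths[OF pt SP_plus_subset(3)] by measurable
  have "Measurable.pred (edge_update n) (\<lambda>z. p \<in> SP_through (Kn n) (fst z) (fst (snd z)))" for p
    unfolding SP_through_def mem_Collect_eq by measurable
  then have m1: "(\<lambda>z. f (fst (snd z)) (fst z)) \<in> borel_measurable (edge_update n)"
    unfolding f_def by (intro measurable_compose[OF measurable_card_Kn_paths[where n = n] measurable_ennreal] SP_plus_subset)
  have "Measurable.pred (edge_update n) (\<lambda>z. p \<in> SP_through (Kn n) (update z) (fst (snd z)))" for p
    unfolding SP_through_def mem_Collect_eq by measurable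
  then have m2: "(\<lambda>z. f (fst (snd z)) (update z)) \<in> borel_measurable (edge_update n)"
    unfolding f_def by (intro measurable_compose[OF measurable_card_Kn_paths[where n = n] measurable_ennreal] SP_plus_subset)
  have "(\<integral>\<^sup>+z. ennreal (card_SP_plus n z) \<partial>edge_update n)
      \<le> (\<integral>\<^sup>+z. f (fst (snd z)) (fst z) + f (fst (snd z)) (update z) \<partial>edge_update n)"
  proof (rule nn_integral_mono_AE, use AE_edge_update[OF n AE_unique_SP] in eventually_elim)
    fix z assume "unique_SP n (fst z) \<and> unique_SP n (update z)"
    then have "card_SP_plus n z \<le> real (card (SP_through (Kn n) (fst z) (fst (snd z)))
        + card (SP_through (Kn n) (update z) (fst (snd z))))"
      unfolding card_SP_plus_eq of_nat_le_iff by (intro card_SP_plus_le) auto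
    then have "ennreal (card_SP_plus n z) \<le> ennreal (real (card (SP_through (Kn n) (fst z) (fst (snd z)))
        + card (SP_through (Kn n) (update z) (fst (snd z)))))"
      by (rule ennreal_leI)
    also have "\<dots> = f (fst (snd z)) (fst z) + f (fst (snd z)) (update z)"
      unfolding f_def of_nat_add by (rule ennreal_plus) auto
    finally show "ennreal (card_SP_plus n z) \<le> f (fst (snd z)) (fst z) + f (fst (snd z)) (update z)" .
  qed
  also have "\<dots> = (\<integral>\<^sup>+z. f (fst (snd z)) (fst z) \<partial>edge_update n) + (\<integral>\<^sup>+z. f (fst (snd z)) (update z) \<partial>edge_update n)"
    by (rule nn_integral_add[OF m1 m2])
  also have "\<dots> = ennreal (1 / real (n * (n - 1))) * (\<Sum>e\<in>arcs (Kn n). \<integral>\<^sup>+w. f e w \<partial>weights n)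
      + ennreal (1 / real (n * (n - 1))) * (\<Sum>e\<in>arcs (Kn n). \<integral>\<^sup>+w. f e w \<partial>weights n)"
    unfolding nn_integral_edge_update_old[OF n m1] nn_integral_edge_update_new[OF n f m2] ..
  also have "\<dots> = ennreal (2 / real (n * (n - 1))) * (\<Sum>e\<in>arcs (Kn n). \<integral>\<^sup>+w. f e w \<partial>weights n)"
    using n by (simp add: distrib_right[symmetric] flip: ennreal_plus add_divide_distrib)
  also have "(\<Sum>e\<in>arcs (Kn n). \<integral>\<^sup>+w. f e w \<partial>weights n) = (\<integral>\<^sup>+w. (\<Sum>e\<in>arcs (Kn n). f e w) \<partial>weights n)"
    by (rule nn_integral_sum[symmetric]) (rule f)
  also have "\<dots> = (\<integral>\<^sup>+w. ennreal (\<Sum>p\<in>SP (Kn n) w. length p) \<partial>weights n)"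
    unfolding f_def sum_card_SP_through[symmetric] by (simp add: sum_ennreal)
  finally show ?thesis .
qed

text \<open>The factor \<open>z\<close> in the proof is chosen to make the bound on \<open>?Z w / z\<close> equal to the number of pairs.\<close>

lemma integral_card_SP_plus_le:
  fixes \<sigma> \<eta> :: real
  assumes n: "n \<ge> 2" and \<sigma>: "\<sigma> > 0" and \<eta>: "\<eta> > 0" and large: "1 \<le> (real n - 1) * \<eta>"
  shows "integral\<^sup>L (edge_update n) (card_SP_plus n)
    \<le> 2 / \<sigma> * (n / (real n - 1) * exp \<sigma> * (1 + \<eta>) * (1 + ln n) - ln ((real n - 1) * \<eta>))"
proof -
  define N where "N = real (n * (n - 1))"
  define l where "l = n * exp \<sigma> * (1 + \<eta>)"
  define z where "z = 1 / ((real n - 1) * \<eta>)"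
  define H where "H = (\<lambda>w. real (\<Sum>p\<in>SP (Kn n) w. length p))"
  define h where "h = (\<integral>w. H w \<partial>weights n)"
  let ?D = "\<lambda>w. \<Sum>(u, v)\<in>arcs (Kn n). set_dist n {u} w v"
  let ?Z = "\<lambda>w. \<Sum>p\<in>Kn_paths n. exp (\<sigma> * length p - l * cost w p)"
  have N: "N = n * (real n - 1)" "N > 0" using n by (auto simp: N_def of_nat_diff)
  have l: "l > 0" using n \<eta> by (simp add: l_def add_pos_pos)
  \<comment> \<open>The assumption \<open>large\<close> gives \<open>z \<le> 1\<close>, hence
    \<open>0 \<le> 1 - ln z\<close>, so the left side of the integrated inequality is not truncated
    by \<open>ennreal\<close>.\<close>
  have z: "z > 0" "0 \<le> 1 - ln z" using n \<eta> large by (simp_all add: z_def ln_div)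
  note pred_SP[measurable]
  \<comment> \<open>Summing over the fixed set \<open>Kn_paths n\<close> makes \<open>H\<close>
    visibly measurable and bounded.\<close>
  have Hsum: "H w = (\<Sum>p\<in>Kn_paths n. if p \<in> SP (Kn n) w then real (length p) else 0)" for w
    unfolding H_def using SP_subset_Kn_paths[of n w]
    by (simp add: sum.inter_restrict[OF finite_Kn_paths, symmetric] Int_absorb1)
  have Hm: "H \<in> borel_measurable (weights n)"
    unfolding Hsum[abs_def] by measurable
  have "\<bar>H w\<bar> \<le> (\<Sum>p\<in>Kn_paths n. real (length p))" for w
    unfolding Hsum by (subst abs_of_nonneg) (auto intro!: sum_nonneg sum_mono)
  then have Hi: "integrable (weights n) H"
    by (intro finite_measure.integrable_const_bound[OF prob_space.finite_measure[OF prob_space_weights],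
      where B = "\<Sum>p\<in>Kn_paths n. real (length p)"] Hm) auto
  have H0: "0 \<le> H w" for w unfolding H_def by (rule of_nat_0_le_iff)
  have h0: "0 \<le> h" unfolding h_def by (rule Bochner_Integration.integral_nonneg) (rule H0)
  have hn: "(\<integral>\<^sup>+w. ennreal (H w) \<partial>weights n) = ennreal h"
    unfolding h_def using Hi H0 by (intro nn_integral_eq_integral) auto
  have "(\<lambda>w. \<sigma> * length p - l * cost w p) \<in> borel_measurable (weights n)" if "p \<in> Kn_paths n" for p
    by (intro borel_measurable_diff borel_measurable_times borel_measurable_const measurable_cost Kn_paths_arcs that)
  then have Zm: "(\<lambda>w. ennreal (?Z w)) \<in> borel_measurable (weights n)"
    by (intro measurable_compose[OF _ measurable_ennreal] borel_measurable_sum measurable_compose[OF _ borel_measurable_exp])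
  have Dm: "?D \<in> borel_measurable (weights n)"
    by (intro borel_measurable_sum) (auto simp: split_beta)
  have nonneg: "AE w in weights n. \<forall>a\<in>arcs (Kn n). 0 \<le> w a"
  proof (subst AE_finite_all)
    show "finite (arcs (Kn n))" by (rule finite_arcs_Kn)
    show "\<forall>a\<in>arcs (Kn n). AE w in weights n. 0 \<le> w a"
      using AE_uniform01 by (auto intro!: AE_PiM_component prob_space_uniform01)
  qed
  have "ennreal (\<sigma> * h + N * (1 - ln z)) = (\<integral>\<^sup>+w. ennreal (\<sigma> * H w + N * (1 - ln z)) \<partial>weights n)"
  proof -
    have "(\<integral>\<^sup>+w. ennreal (\<sigma> * H w + N * (1 - ln z)) \<partial>weights n)
        = ennreal (\<integral>w. \<sigma> * H w + N * (1 - ln z) \<partial>weights n)"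
      using Hi H0 \<sigma> N z by (intro nn_integral_eq_integral) auto
    also have "(\<integral>w. \<sigma> * H w + N * (1 - ln z) \<partial>weights n) = \<sigma> * h + N * (1 - ln z)"
      using Hi by (simp add: h_def prob_space.prob_space[OF prob_space_weights])
    finally show ?thesis by simp
  qed
  also have "\<dots> \<le> (\<integral>\<^sup>+w. ennreal l * ?D w + ennreal (1 / z) * ennreal (?Z w) \<partial>weights n)"
  proof (rule nn_integral_mono_AE, use AE_unique_SP nonneg in eventually_elim)
    fix w assume "unique_SP n w" "\<forall>a\<in>arcs (Kn n). 0 \<le> w a"
    then show "ennreal (\<sigma> * H w + N * (1 - ln z)) \<le> ennreal l * ?D w + ennreal (1 / z) * ennreal (?Z w)"
      unfolding H_def N_def by (intro sum_length_SP_le l z) auto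
  qed
  also have "\<dots> = ennreal l * (\<integral>\<^sup>+w. ?D w \<partial>weights n) + ennreal (1 / z) * (\<integral>\<^sup>+w. ennreal (?Z w) \<partial>weights n)"
    using Zm Dm by (subst nn_integral_add) (simp_all add: nn_integral_cmult)
  also have "\<dots> \<le> ennreal l * ennreal (n * (1 + ln n)) + ennreal (1 / z) * ennreal (n / \<eta>)"
    using nn_integral_partition_function[of n \<eta> \<sigma>] n \<eta>
    by (intro add_mono mult_left_mono nn_integral_sum_dist) (auto simp: l_def)
  also have "\<dots> = ennreal (l * (n * (1 + ln n)) + 1 / z * (n / \<eta>))"
    using l z n \<eta> by (subst ennreal_plus) (auto simp flip: ennreal_mult intro!: mult_nonneg_nonneg)
  also have "1 / z * (n / \<eta>) = N" using \<eta> by (simp add: z_def N)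
  finally have "\<sigma> * h + N * (1 - ln z) \<le> l * (n * (1 + ln n)) + N"
    using l n N by (subst (asm) ennreal_le_iff) auto
  moreover have "l * (n * (1 + ln n)) = N * (n / (real n - 1) * exp \<sigma> * (1 + \<eta>) * (1 + ln n))"
    using n by (simp add: l_def N)
  moreover have "ln z = - ln ((real n - 1) * \<eta>)" using n \<eta> by (simp add: z_def ln_div)
  \<comment> \<open>By the choice of \<open>z\<close> the two terms \<open>N\<close> cancel, so only
    \<open>N * ln z\<close> remains beside the distance term.\<close>
  ultimately have "\<sigma> * h \<le> N * (n / (real n - 1) * exp \<sigma> * (1 + \<eta>) * (1 + ln n) - ln ((real n - 1) * \<eta>))"
    by (simp add: algebra_simps)
  then have hB: "2 / N * h \<le> 2 / \<sigma> * (n / (real n - 1) * exp \<sigma> * (1 + \<eta>) * (1 + ln n) - ln ((real n - 1) * \<eta>))"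
    using N(2) \<sigma> by (simp add: divide_simps mult_ac)
  have "ennreal (integral\<^sup>L (edge_update n) (card_SP_plus n)) = (\<integral>\<^sup>+z. ennreal (card_SP_plus n z) \<partial>edge_update n)"
    by (rule nn_integral_eq_integral[symmetric, OF integrable_card_SP(1)[OF n]]) (simp add: card_SP_plus_eq)
  also have "\<dots> \<le> ennreal (2 / N) * (\<integral>\<^sup>+w. ennreal (H w) \<partial>weights n)"
    unfolding N_def H_def by (rule nn_integral_card_SP_plus_le[OF n])
  also have "\<dots> = ennreal (2 / N * h)"
    unfolding hn using N h0 by (simp flip: ennreal_mult)
  finally have "integral\<^sup>L (edge_update n) (card_SP_plus n) \<le> 2 / N * h"
    using N h0 by (subst (asm) ennreal_le_iff) auto
  with hB show ?thesis by linarith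
qed

theorem theorem34:
  shows "(\<forall>n\<ge>2. integrable (edge_update n) (card_SP_minus n) \<and>
                 integrable (edge_update n) (card_SP_plus n) \<and>
                 integral\<^sup>L (edge_update n) (card_SP_minus n) =
                 integral\<^sup>L (edge_update n) (card_SP_plus n)) \<and>
         (\<exists>\<epsilon> :: nat \<Rightarrow> real. \<epsilon> \<in> o(\<lambda>_. 1) \<and>
            (\<forall>n\<ge>2. integral\<^sup>L (edge_update n) (card_SP_plus n) \<le> (2 + \<epsilon> n) * ln (real n)))"
proof -
  \<comment> \<open>Here \<open>\<sigma> = 1 / sqrt (ln n)\<close> and
    \<open>\<eta> = 1 / ln n\<close>. As \<sigma> tends to 0,
    \<open>2 * (exp \<sigma> - 1) / \<sigma>\<close> tends to 2, while \<sigma> decays so slowly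
    that the relative errors \<open>\<eta> / \<sigma>\<close> and
    \<open>ln (ln n) / (\<sigma> * ln n)\<close> still vanish.\<close>
  define B :: "nat \<Rightarrow> real" where "B = (\<lambda>n. 2 / (1 / sqrt (ln n)) * (n / (real n - 1) * exp (1 / sqrt (ln n)) * (1 + 1 / ln n) * (1 + ln n)
    - ln ((real n - 1) * (1 / ln n))))"
  define \<epsilon> where "\<epsilon> = (\<lambda>n. B n / ln (real n) - 2)"
  have "\<epsilon> \<in> o(\<lambda>_. 1)"
    unfolding \<epsilon>_def B_def by real_asymp
  moreover have "integral\<^sup>L (edge_update n) (card_SP_plus n) \<le> (2 + \<epsilon> n) * ln (real n)" if n: "n \<ge> 2" for n
  proof -
    \<comment> \<open>The second bound gives \<open>1 \<le> (n - 1) / ln n\<close>, which is the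
      assumption \<open>large\<close> of \<open>integral_card_SP_plus_le\<close> for
      \<open>\<eta> = 1 / ln n\<close>.\<close>
    have L: "0 < ln (real n)" "ln (real n) \<le> real n - 1"
      using n ln_le_minus_one[of "real n"] by auto
    have "integral\<^sup>L (edge_update n) (card_SP_plus n) \<le> B n"
      unfolding B_def by (rule integral_card_SP_plus_le[OF n]) (use L in auto)
    also have "B n = (2 + \<epsilon> n) * ln (real n)"
      using L by (simp add: \<epsilon>_def)
    finally show ?thesis .
  qed
  ultimately show ?thesis
    using integrable_card_SP integral_card_SP_minus_eq_plus by blast
qed

end
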